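(* Let $p\in\mathcal{A}\cap\mathcal{N}$ with $1<p^-\le p^+<\infty$. Then there exist constants $s_0>1$, $c>0$ and $\epsilon>0$, depending only on $n,p^-,p^+,[p]_{\mathcal A},[p]_{\mathcal N}$, such that for all $s\in[1,s_0]$, all cubes $Q\subset\mathbb{R}^n$ with $|Q|\le1$, and all $f$ with $\|f\|_{L^{p(\cdot)/s}+L^{p(\cdot)}+L^\infty}\le1$, we have $$\left(\frac1{|Q|}\int_Q\left(\frac1{|Q|}\int_Q|f(y)|\,dy\right)^{s\,p(x)}dx\right)^{\frac1s}\le c\left(\frac1{|Q|}\int_Q|f(x)|^{p(x)/s}\,dx\right)^{s}+|Q|^{\epsilon}.$$
   Context: A variable exponent is a measurable function $p:\mathbb{R}^n\to[1,\infty]$; $p^-,p^+\in[1,\infty]$ are bounds with $p^-\le p(x)\le p^+$ for all $x\in\mathbb{R}^n$. The conjugate exponent $p'$ is defined pointwise by $\frac1{p(x)}+\frac1{p'(x)}=1$ (with $1/\infty=0$). For a measurable exponent $q$ on $\mathbb{R}^n$ the norm is $\|f\|_{q(\cdot)}=\inf\{\lambda>0:\int_{\mathbb{R}^n}|f(x)/\lambda|^{q(x)}\,dx\le1\}$, with the convention $t^\infty=0$ for $t\in[0,1]$ and $t^\infty=\infty$ for $t>1$; $L^{q(\cdot)}(\mathbb{R}^n)$ is the set of $f\in L^1_{\mathrm{loc}}(\mathbb{R}^n)$ with finite norm. Class $\mathcal{A}$: $p\in\mathcal{A}$ iff $[p]_{\mathcal A}:=\sup_Q\frac{\|\mathbf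 1_Q\|_{p(\cdot)}\|\mathbf 1_Q\|_{p'(\cdot)}}{|Q|}<\infty$, the supremum over all cubes $Q\subset\mathbb{R}^n$. Class $\mathcal{N}$ (Nekvinda condition): $p\in\mathcal N$ iff for some $p_\infty\in[p^-,p^+]$, with $\frac1{r(x)}:=\left|\frac1{p(x)}-\frac1{p_\infty}\right|$, one has $1\in L^{r(\cdot)}(\mathbb{R}^n)$; $[p]_{\mathcal N}:=\|1\|_{r(\cdot)}$. Sum space: $\|f\|_{L^{p(\cdot)/s}+L^{p(\cdot)}+L^\infty}$ is the infimum of $\|g_1\|_{p(\cdot)/s}+\|g_2\|_{p(\cdot)}+\|g_3\|_\infty$ over all decompositions $f=g_1+g_2+g_3$ with $g_1\in L^{p(\cdot)/s}(\mathbb{R}^n)$, $g_2\in L^{p(\cdot)}(\mathbb{R}^n)$, $g_3\in L^\infty(\mathbb{R}^n)$. *)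

theory Defs
  imports "HOL-Analysis.Analysis"
begin

(* Exponents take values in ereal, where 1 / 0 = \<infinity> and 1 / \<infinity> = 0. *)

(* t^q for t in [0,\<infinity>] and 0 < q \<le> \<infinity>. *)
definition epow :: "ennreal \<Rightarrow> ereal \<Rightarrow> ennreal" where
  "epow t q =
    (if q = \<infinity> then (if t \<le> 1 then 0 else \<infinity>)
     else if t = \<infinity> then \<infinity>
     else ennreal (enn2real t powr real_of_ereal q))"

definition variable_exponent :: "(real ^ 'n \<Rightarrow> ereal) \<Rightarrow> bool" where
  "variable_exponent p \<longleftrightarrow> p \<in> borel_measurable lebesgue \<and> (\<forall>x. 1 \<le> p x)"

definition conj_exponent :: "(real ^ 'n \<Rightarrow> ereal) \<Rightarrow> real ^ 'n \<Rightarrow> ereal" where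
  "conj_exponent p x = 1 / (1 - 1 / p x)"

lemma conj_exponent:
  assumes "1 \<le> p x"
  shows "1 / p x + 1 / conj_exponent p x = 1"
  using assms
  by (cases "p x") (auto simp: conj_exponent_def one_ereal_def field_simps zero_ereal_def)

(* The infimum is \<infinity> if no t is admissible. *)
definition vnorm :: "(real ^ 'n \<Rightarrow> ereal) \<Rightarrow> (real ^ 'n \<Rightarrow> real) \<Rightarrow> ennreal" where
  "vnorm q f =
    Inf {ennreal t | t. 0 < t \<and>
      (\<integral>\<^sup>+ x. epow (ennreal (\<bar>f x\<bar> / t)) (q x) \<partial>lebesgue) \<le> 1}"

definition locally_integrable :: "(real ^ 'n \<Rightarrow> real) \<Rightarrow> bool" where
  "locally_integrable f \<longleftrightarrow> (\<forall>K. compact K \<longrightarrow> f absolutely_integrable_on K)"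

definition vspace :: "(real ^ 'n \<Rightarrow> ereal) \<Rightarrow> (real ^ 'n \<Rightarrow> real) set" where
  "vspace q = {f. locally_integrable f \<and> vnorm q f < \<infinity>}"

definition cubes :: "(real ^ 'n) set set" where
  "cubes = {cbox a (\<chi> i. a $ i + l) | a l. 0 < l}"

definition const_A :: "(real ^ 'n \<Rightarrow> ereal) \<Rightarrow> ennreal" where
  "const_A p =
    (SUP Q\<in>cubes. vnorm p (indicator Q) * vnorm (conj_exponent p) (indicator Q)
       / emeasure lebesgue Q)"

definition class_A :: "(real ^ 'n \<Rightarrow> ereal) set" where
  "class_A = {p. const_A p < \<infinity>}"

definition nekvinda_exponent :: "(real ^ 'n \<Rightarrow> ereal) \<Rightarrow> ereal \<Rightarrow> real ^ 'n \<Rightarrow> ereal" where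
  "nekvinda_exponent p p_inf x = 1 / \<bar>1 / p x - 1 / p_inf\<bar>"

definition nekvinda_limit :: "ereal \<Rightarrow> ereal \<Rightarrow> (real ^ 'n \<Rightarrow> ereal) \<Rightarrow> ereal \<Rightarrow> bool" where
  "nekvinda_limit pm pp p p_inf \<longleftrightarrow>
    p_inf \<in> {pm..pp} \<and> (\<lambda>x. 1) \<in> vspace (nekvinda_exponent p p_inf)"

definition class_N :: "ereal \<Rightarrow> ereal \<Rightarrow> (real ^ 'n \<Rightarrow> ereal) set" where
  "class_N pm pp = {p. \<exists>p_inf. nekvinda_limit pm pp p p_inf}"

(* For a variable exponent with 1 \<le> pm there is at most one admissible p_inf, since for
   two different ones 1 / r_1 + 1 / r_2 would be bounded below on the whole space;
   so the choice is immaterial. *)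
definition const_N :: "ereal \<Rightarrow> ereal \<Rightarrow> (real ^ 'n \<Rightarrow> ereal) \<Rightarrow> ennreal" where
  "const_N pm pp p =
    vnorm (nekvinda_exponent p (SOME p_inf. nekvinda_limit pm pp p p_inf)) (\<lambda>x. 1)"

(* The exponent constantly \<infinity> gives the space L^\<infinity> with the essential supremum norm.
   Functions are identified up to null sets. *)
definition sum_norm :: "(real ^ 'n \<Rightarrow> ereal) \<Rightarrow> real \<Rightarrow> (real ^ 'n \<Rightarrow> real) \<Rightarrow> ennreal" where
  "sum_norm p s f =
    Inf {vnorm (\<lambda>x. p x / ereal s) g1 + vnorm p g2 + vnorm (\<lambda>x. \<infinity>) g3 | g1 g2 g3.
      g1 \<in> vspace (\<lambda>x. p x / ereal s) \<and> g2 \<in> vspace p \<and> g3 \<in> vspace (\<lambda>x. \<infinity>) \<and>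
      (AE x in lebesgue. f x = g1 x + g2 x + g3 x)}"

definition avg :: "(real ^ 'n) set \<Rightarrow> (real ^ 'n \<Rightarrow> ennreal) \<Rightarrow> ennreal" where
  "avg Q g = (\<integral>\<^sup>+ x\<in>Q. g x \<partial>lebesgue) / emeasure lebesgue Q"

end

theory Submission
  imports Defs
begin

text \<open>
Let v be the volume of a cube Q of side l \<le> 1 and let T \<ge> 1 be the level of Q: the number for
which T^p has integral 1 over Q. It is the reciprocal of the norm of the indicator of Q. Let S be the
level of Q for the conjugate exponent p'. Class A says that 1 \<le> K v T S, where K bounds the constant
[p]_A. The proof studies the normalized weight u = T^p v, which has mean 1 on Q, and compares every mean
of f with a power of T.

The bound on v T S turns the mean of S^{p'} v, which is 1, into a bound for the mean of u^{-1/(p-1)} on Q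
(dual_weight_le, exists_level_dual_bound). A cube R inside Q has a larger level T_R, so T is a power of
T_R with exponent \<theta> in [0,1], and on R the weight T^p is a constant times the power \<theta> of the
normalized weight of R. The bound on R therefore forbids T^p from concentrating on a small part of R,
for all R inside Q at once and with the same constants: T^p satisfies an A-infinity condition on Q
(A_infinity_level). The Gehring argument converts this into a reverse Hoelder inequality, a bound for the
mean of u^{1+\<eta>} (reverse_holder, level_reverse_holder). Because class A is symmetric in p and p', the
same inequality for p' bounds the mean of u^{-(1+\<eta>)/(p-1)} (level_space_constants). These two bounds
are all that is needed later: every power of u between the two exponents has a bounded mean.

Let t be the mean of |f| on Q. Young's inequality against u shows that a function whose modular with
exponent p/s is at most 1 has mean at most a constant times T^s, provided s is close to 1; the small gain
\<eta> pays for the loss in the exponent (mean_le_level). Hence t \<le> C0 T^s if the sum norm of f is at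
most 1. If t is at most T^{-a}, the left-hand side is at most |Q|^\<epsilon> because T is at least a power
of 1/|Q| (small_mean). Otherwise t is comparable with T^\<theta> for some \<theta> in [-a,s]. Then
t^p is comparable with v^{-\<theta>} u^\<theta>, so the left-hand side is at most a multiple of
v^{-\<theta>} (mean_powr_upper_bound). Young's inequality, now against a power of u, shows that
a function of mean t has a modular that is at least as large (modular_lower_bound).
\<close>

section \<open>Half-open cubes and their dyadic subdivision\<close>

text \<open>
Half-open cubes are partitioned exactly by their dyadic children, so all sums over generations are
honest sums over disjoint sets. They differ from closed cubes by null sets only.
\<close>

definition hbox :: "real ^ 'n \<Rightarrow> real \<Rightarrow> (real ^ 'n) set" where
  "hbox a l = {x. \<forall>i. a $ i \<le> x $ i \<and> x $ i < a $ i + l}"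

text \<open>
The children of a cube are indexed by the set of coordinates in which they occupy the upper half.
\<close>

definition child :: "real ^ 'n \<Rightarrow> real \<Rightarrow> 'n set \<Rightarrow> real ^ 'n" where
  "child a l I = (\<chi> i. if i \<in> I then a $ i + l / 2 else a $ i)"

lemma sets_hbox [measurable, simp]: "hbox a l \<in> sets lebesgue"
proof -
  have "hbox a l \<in> sets borel"
    unfolding hbox_def by measurable
  then show ?thesis
    by simp
qed

lemma
  fixes a :: "real ^ 'n"
  assumes "0 < l"
  shows emeasure_cube: "emeasure lebesgue (cbox a (\<chi> i. a $ i + l)) = ennreal (l ^ CARD('n))"
    and emeasure_hbox: "emeasure lebesgue (hbox a l) = ennreal (l ^ CARD('n))"
proof -
  let ?b = "(\<chi> i. a $ i + l) :: real ^ 'n"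
  have c: "measure lborel (cbox a ?b) = l ^ CARD('n)"
    using assms by (subst content_cbox_cart) (auto simp: interval_ne_empty_cart)
  have ec: "emeasure lebesgue (cbox a ?b) = ennreal (l ^ CARD('n))"
    using emeasure_eq_ennreal_measure[of lborel "cbox a ?b"] emeasure_lborel_cbox_finite[of a ?b] c
    by (simp add: less_top)
  have eb: "emeasure lebesgue (box a ?b) = emeasure lebesgue (cbox a ?b)"
    by (simp add: emeasure_lborel_box_eq emeasure_lborel_cbox_eq)
  have sub: "box a ?b \<subseteq> hbox a l" "hbox a l \<subseteq> cbox a ?b"
    by (auto simp: hbox_def mem_box_cart less_imp_le)
  show "emeasure lebesgue (cbox a (\<chi> i. a $ i + l)) = ennreal (l ^ CARD('n))"
    by (rule ec)
  show "emeasure lebesgue (hbox a l) = ennreal (l ^ CARD('n))"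
    using emeasure_mono[OF sub(1), of lebesgue] emeasure_mono[OF sub(2), of lebesgue] ec eb
    by simp
qed

lemma measure_hbox: "0 < l \<Longrightarrow> measure lebesgue (hbox a l) = l ^ CARD('n)" for a :: "real ^ 'n"
  by (simp add: measure_def emeasure_hbox del: emeasure_completion)

lemma hbox_AE_eq_cube:
  fixes a :: "real ^ 'n"
  assumes "0 < l"
  shows "AE x in lebesgue. x \<in> cbox a (\<chi> i. a $ i + l) \<longleftrightarrow> x \<in> hbox a l"
proof -
  let ?Q = "cbox a (\<chi> i. a $ i + l)"
  have sub: "hbox a l \<subseteq> ?Q"
    by (auto simp: hbox_def mem_box_cart less_imp_le)
  have "emeasure lebesgue (?Q - hbox a l) = 0"
    using sub by (subst emeasure_Diff) (auto simp: emeasure_cube emeasure_hbox assms simp del: emeasure_completion)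
  then have "?Q - hbox a l \<in> null_sets lebesgue"
    by (intro null_setsI) auto
  then show ?thesis
    by (rule AE_I'[of "?Q - hbox a l"]) (use sub in auto)
qed

lemma hbox_split:
  assumes "0 < l"
  shows "hbox a l = (\<Union>I. hbox (child a l I) (l / 2))"
    and "disjoint_family (\<lambda>I. hbox (child a l I) (l / 2))"
proof -
  show "hbox a l = (\<Union>I. hbox (child a l I) (l / 2))"
  proof (intro set_eqI iffI)
    fix x assume x: "x \<in> hbox a l"
    have "x \<in> hbox (child a l {i. a $ i + l / 2 \<le> x $ i}) (l / 2)"
      using x by (auto simp: hbox_def child_def not_le algebra_simps)
    then show "x \<in> (\<Union>I. hbox (child a l I) (l / 2))"
      by blast
  next
    fix x assume "x \<in> (\<Union>I. hbox (child a l I) (l / 2))"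
    then obtain I where "x \<in> hbox (child a l I) (l / 2)"
      by blast
    then have "a $ i \<le> x $ i \<and> x $ i < a $ i + l" for i
      using assms by (cases "i \<in> I") (force simp: hbox_def child_def dest: spec[of _ i])+
    then show "x \<in> hbox a l"
      by (simp add: hbox_def)
  qed
  have "I = {i. a $ i + l / 2 \<le> x $ i}" if "x \<in> hbox (child a l I) (l / 2)" for x I
  proof (rule set_eqI)
    fix i
    show "i \<in> I \<longleftrightarrow> i \<in> {i. a $ i + l / 2 \<le> x $ i}"
      using that by (cases "i \<in> I") (force simp: hbox_def child_def dest: spec[of _ i])+
  qed
  then show "disjoint_family (\<lambda>I. hbox (child a l I) (l / 2))"
    unfolding disjoint_family_on_def by blast
qed

lemma child_subset: "0 < l \<Longrightarrow> hbox (child a l I) (l / 2) \<subseteq> hbox a l"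
  using hbox_split(1)[of l a] by blast

lemma set_integrable_bounded:
  fixes g :: "real ^ 'n \<Rightarrow> real"
  assumes "g \<in> borel_measurable lebesgue" "\<And>x. \<bar>g x\<bar> \<le> B"
    and "E \<in> sets lebesgue" "E \<subseteq> hbox a l" "0 < l"
  shows "set_integrable lebesgue E g"
proof -
  have "emeasure lebesgue E \<le> emeasure lebesgue (hbox a l)"
    using assms by (intro emeasure_mono) auto
  then have "emeasure lebesgue E < \<infinity>"
    using assms(5) by (simp add: emeasure_hbox le_less_trans del: emeasure_completion)
  then have "set_integrable lebesgue E (\<lambda>x. B)"
    using assms(3) by (simp add: set_integrable_def)
  then show ?thesis
    by (rule set_integrable_bound)
       (use assms in \<open>auto simp: set_borel_measurable_def intro!: AE_I2 intro: order_trans[OF _ abs_ge_self]\<close>)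
qed

lemma set_integral_hbox_split:
  fixes g :: "real ^ 'n \<Rightarrow> real"
  assumes "0 < l" "g \<in> borel_measurable lebesgue" "\<And>x. \<bar>g x\<bar> \<le> B"
  shows "(LINT x:hbox a l|lebesgue. g x)
    = (\<Sum>I\<in>UNIV. LINT x:hbox (child a l I) (l / 2)|lebesgue. g x)"
  unfolding hbox_split(1)[OF assms(1), of a]
  by (rule set_integral_finite_Union)
     (use assms hbox_split(2)[OF assms(1), of a] in \<open>auto intro!: set_integrable_bounded\<close>)

lemma set_integrable_const_within:
  "E \<in> sets lebesgue \<Longrightarrow> E \<subseteq> hbox a l \<Longrightarrow> 0 < l \<Longrightarrow> set_integrable lebesgue E (\<lambda>x. c :: real)"
  for a :: "real ^ 'n"
  by (rule set_integrable_bounded[where B = "\<bar>c\<bar>"]) auto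

lemma set_integral_const_within:
  "E \<in> sets lebesgue \<Longrightarrow> E \<subseteq> hbox a l \<Longrightarrow> 0 < l \<Longrightarrow> (LINT x:E|lebesgue. c) = c * measure lebesgue E"
  for a :: "real ^ 'n" and c :: real
proof -
  assume *: "E \<in> sets lebesgue" "E \<subseteq> hbox a l" "0 < l"
  have "emeasure lebesgue E \<le> emeasure lebesgue (hbox a l)"
    using * by (intro emeasure_mono) auto
  then have "emeasure lebesgue E < \<infinity>"
    using * by (simp add: emeasure_hbox le_less_trans del: emeasure_completion)
  then show ?thesis
    using *(1) by (simp add: set_lebesgue_integral_def mult.commute)
qed

lemma set_integral_const_hbox: "0 < l \<Longrightarrow> (LINT x:hbox a l|lebesgue. c) = c * l ^ CARD('n)"
  for a :: "real ^ 'n" and c :: real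
  by (subst set_integral_const_within[OF _ order_refl]) (auto simp: measure_hbox)

section \<open>The stopping-time argument on the dyadic tree\<close>

definition mass :: "(real ^ 'n \<Rightarrow> real) \<Rightarrow> real ^ 'n \<Rightarrow> real \<Rightarrow> real" where
  "mass w a l = (LINT x:hbox a l|lebesgue. w x)"

definition mean :: "(real ^ 'n \<Rightarrow> real) \<Rightarrow> real ^ 'n \<Rightarrow> real \<Rightarrow> real" where
  "mean w a l = mass w a l / l ^ CARD('n)"

text \<open>
After k subdivisions this is the integral over the cube of the power 1+\<eta> of the function that equals
the mean of w on each dyadic descendant of generation k.
\<close>

primrec dyadic_energy :: "(real ^ 'n \<Rightarrow> real) \<Rightarrow> real \<Rightarrow> nat \<Rightarrow> real ^ 'n \<Rightarrow> real \<Rightarrow> real" where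
  "dyadic_energy w \<eta> 0 a l = mean w a l powr \<eta> * mass w a l"
| "dyadic_energy w \<eta> (Suc k) a l = (\<Sum>I\<in>UNIV. dyadic_energy w \<eta> k (child a l I) (l / 2))"

text \<open>
The union of the maximal dyadic descendants, down to generation k, on which the mean of w exceeds t.
\<close>

primrec stopping_set :: "(real ^ 'n \<Rightarrow> real) \<Rightarrow> real \<Rightarrow> nat \<Rightarrow> real ^ 'n \<Rightarrow> real \<Rightarrow> (real ^ 'n) set" where
  "stopping_set w t 0 a l = (if t < mean w a l then hbox a l else {})"
| "stopping_set w t (Suc k) a l =
    (if t < mean w a l then hbox a l else \<Union>I. stopping_set w t k (child a l I) (l / 2))"

lemma sets_stopping_set [measurable, simp]: "stopping_set w t k a l \<in> sets lebesgue"
  by (induction k arbitrary: a l) auto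

lemma stopping_set_subset: "0 < l \<Longrightarrow> stopping_set w t k a l \<subseteq> hbox a l"
proof (induction k arbitrary: a l)
  case (Suc k)
  have "stopping_set w t k (child a l I) (l / 2) \<subseteq> hbox a l" for I
    using Suc.IH[of "l / 2" "child a l I"] child_subset[OF Suc.prems, of a I] Suc.prems by auto
  then show ?case
    by auto
qed auto

locale bounded_weight =
  fixes w :: "real ^ 'n \<Rightarrow> real" and m B :: real
  assumes measurable_w [measurable]: "w \<in> borel_measurable lebesgue"
    and m_pos: "0 < m" and m_le: "\<And>x. m \<le> w x" and w_le: "\<And>x. w x \<le> B"
begin

lemma abs_w: "\<bar>w x\<bar> \<le> B"
  using m_pos m_le[of x] w_le[of x] by simp

lemma integrable_w: "E \<in> sets lebesgue \<Longrightarrow> E \<subseteq> hbox a l \<Longrightarrow> 0 < l \<Longrightarrow> set_integrable lebesgue E w"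
  using abs_w by (intro set_integrable_bounded) auto

lemma mass_split: "0 < l \<Longrightarrow> mass w a l = (\<Sum>I\<in>UNIV. mass w (child a l I) (l / 2))"
  unfolding mass_def by (rule set_integral_hbox_split[where B = B]) (use abs_w in auto)

lemma mass_pos: "0 < l \<Longrightarrow> 0 < mass w a l"
proof -
  assume l: "0 < l"
  have "0 < m * l ^ CARD('n)"
    using m_pos l by simp
  also have "\<dots> = (LINT x:hbox a l|lebesgue. m)"
    using l by (simp add: set_integral_const_hbox)
  also have "\<dots> \<le> mass w a l"
    unfolding mass_def using l m_le by (intro set_integral_mono integrable_w set_integrable_const_within) auto
  finally show ?thesis .
qed

lemma mean_pos: "0 < l \<Longrightarrow> 0 < mean w a l"
  using mass_pos by (simp add: mean_def)

text \<open>
Volume is doubling along the tree, so a mean cannot jump by more than the number of children in one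
generation. This controls the means at the cubes where the stopping process ends.
\<close>

lemma mean_child_le: "0 < l \<Longrightarrow> mean w (child a l I) (l / 2) \<le> 2 ^ CARD('n) * mean w a l"
proof -
  assume l: "0 < l"
  have "mass w (child a l I) (l / 2) \<le> mass w a l"
    unfolding mass_split[OF l]
    using mass_pos[of "l / 2"] l by (intro member_le_sum) (auto intro: less_imp_le)
  then show ?thesis
    using l by (simp add: mean_def field_simps power_divide)
qed

lemma integral_UN_stopping_set:
  fixes g :: "real ^ 'n \<Rightarrow> real"
  assumes "0 < l" "g \<in> borel_measurable lebesgue" "\<And>x. \<bar>g x\<bar> \<le> b"
  shows "(LINT x:(\<Union>I. stopping_set w t k (child a l I) (l / 2))|lebesgue. g x)
    = (\<Sum>I\<in>UNIV. LINT x:stopping_set w t k (child a l I) (l / 2)|lebesgue. g x)"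
proof (rule set_integral_finite_Union[where A = "\<lambda>I. stopping_set w t k (child a l I) (l / 2)"])
  show "disjoint_family (\<lambda>I. stopping_set w t k (child a l I) (l / 2))"
    using stopping_set_subset[of "l / 2" w t k] hbox_split(2)[OF assms(1), of a] assms(1)
    unfolding disjoint_family_on_def by (simp add: disjoint_iff subset_iff) metis
  show "set_integrable lebesgue (stopping_set w t k (child a l I) (l / 2)) g" for I
    using assms stopping_set_subset[of "l / 2" w t k "child a l I"]
    by (intro set_integrable_bounded[where a = "child a l I" and l = "l / 2"]) auto
qed auto

text \<open>
The mean of w exceeds t on each of the disjoint cubes that make up the stopping set.
\<close>

lemma stopping_set_heavy: "0 < l \<Longrightarrow> 0 \<le> (LINT x:stopping_set w t k a l|lebesgue. w x - t)"
proof (induction k arbitrary: a l)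
  have top: "0 \<le> (LINT x:hbox a l|lebesgue. w x - t)" if "t < mean w a l" "0 < l" for a l
  proof -
    have "(LINT x:hbox a l|lebesgue. w x - t) = mass w a l - t * l ^ CARD('n)"
      unfolding mass_def using that(2)
      by (subst set_integral_diff)
         (auto intro!: integrable_w set_integrable_const_within simp: set_integral_const_hbox)
    then show ?thesis
      using that by (simp add: mean_def field_simps)
  qed
  {
    case 0
    then show ?case
      using top[of a l] by (simp add: set_lebesgue_integral_def)
  next
    case (Suc k)
    show ?case
    proof (cases "t < mean w a l")
      case True
      then show ?thesis
        using top Suc.prems by simp
    next
      case False
      have b: "\<bar>w x - t\<bar> \<le> B + \<bar>t\<bar>" for x
        using abs_w[of x] by linarith
      have "0 \<le> (\<Sum>I\<in>UNIV. LINT x:stopping_set w t k (child a l I) (l / 2)|lebesgue. w x - t)"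
        using Suc.prems by (intro sum_nonneg Suc.IH) auto
      also have "\<dots> = (LINT x:(\<Union>I. stopping_set w t k (child a l I) (l / 2))|lebesgue. w x - t)"
        using b Suc.prems by (intro integral_UN_stopping_set[symmetric]) auto
      finally show ?thesis
        using False by simp
    qed
  }
qed

end

text \<open>
The A-infinity condition in its weakest quantitative form, on all cubes inside one fixed cube: a set that
fills at most half of a cube carries at most the fraction \<beta> of its mass.
\<close>

locale A_infinity_weight = bounded_weight w m B
  for w :: "real ^ 'n \<Rightarrow> real" and m B :: real +
  fixes a0 :: "real ^ 'n" and l0 \<beta> :: real
  assumes A_infinity: "\<And>a l E. 0 < l \<Longrightarrow> hbox a l \<subseteq> hbox a0 l0 \<Longrightarrow> E \<in> sets lebesgue \<Longrightarrow>
      E \<subseteq> hbox a l \<Longrightarrow> measure lebesgue E \<le> measure lebesgue (hbox a l) / 2 \<Longrightarrow>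
      (LINT x:E|lebesgue. w x) \<le> \<beta> * mass w a l"
begin

text \<open>
With the threshold at twice the mean, the stopping set fills at most half of the cube by Chebyshev's
inequality, so the A-infinity condition applies to it.
\<close>

lemma stopping_set_light:
  assumes "0 < l" "hbox a l \<subseteq> hbox a0 l0"
  shows "(LINT x:stopping_set w (2 * mean w a l) k a l|lebesgue. w x) \<le> \<beta> * mass w a l"
proof (rule A_infinity[OF assms])
  let ?t = "2 * mean w a l" and ?E = "stopping_set w (2 * mean w a l) k a l"
  have "0 \<le> (LINT x:?E|lebesgue. w x - ?t)"
    using assms(1) by (rule stopping_set_heavy)
  also have "\<dots> = (LINT x:?E|lebesgue. w x) - ?t * measure lebesgue ?E"
    using assms(1) stopping_set_subset[OF assms(1), of w ?t k a]
    by (subst set_integral_diff)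
       (auto intro!: integrable_w[of _ a l] set_integrable_const_within[of _ a l] simp: set_integral_const_within[of _ a l])
  finally have "?t * measure lebesgue ?E \<le> (LINT x:?E|lebesgue. w x)"
    by simp
  also have "\<dots> \<le> mass w a l"
    unfolding mass_def set_lebesgue_integral_def
    using integrable_w[of ?E a l] integrable_w[of "hbox a l" a l] stopping_set_subset[OF assms(1), of w ?t k a]
      assms(1) abs_w order_trans[OF less_imp_le[OF m_pos] m_le]
    by (intro integral_mono) (auto simp: set_integrable_def split: split_indicator)
  also have "\<dots> = mean w a l * measure lebesgue (hbox a l)"
    using assms(1) by (simp add: mean_def measure_hbox)
  finally show "measure lebesgue ?E \<le> measure lebesgue (hbox a l) / 2"
    using mean_pos[OF assms(1), of a] by simp
  show "?E \<subseteq> hbox a l"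
    using assms(1) by (rule stopping_set_subset)
qed simp

text \<open>
Gehring's argument on a finite tree. Outside the stopping set the dyadic means are at most twice the mean
A of the cube. On each stopping cube the bound holds by induction, with a mean at most a
dimensional factor larger than the threshold; the stopping cubes carry at most the fraction \<beta> of the
mass. The condition on C says that these two contributions add up to at most C A^\<eta> times the mass.
The finite depth replaces the usual a priori finiteness of the integral.
\<close>

lemma dyadic_reverse_holder:
  fixes C \<eta> :: real
  assumes "0 \<le> C" "0 \<le> \<eta>" and C: "2 powr \<eta> + C * (2 * 2 ^ CARD('n)) powr \<eta> * \<beta> \<le> C"
    and "0 < l" "hbox a l \<subseteq> hbox a0 l0"
  shows "dyadic_energy w \<eta> k a l \<le> C * mean w a l powr \<eta> * mass w a l"
proof -
  let ?D = "2 ^ CARD('n) :: real"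
  \<comment> \<open>P is the claim. S bounds the energy for any threshold t that is not below the mean,
    by the part outside and the part inside the stopping set; it needs P only in the smaller
    depths.\<close>
  define P where "P k \<longleftrightarrow> (\<forall>a l. 0 < l \<longrightarrow> hbox a l \<subseteq> hbox a0 l0 \<longrightarrow>
    dyadic_energy w \<eta> k a l \<le> C * mean w a l powr \<eta> * mass w a l)" for k
  define S where "S k \<longleftrightarrow> (\<forall>a l t. 0 < l \<longrightarrow> hbox a l \<subseteq> hbox a0 l0 \<longrightarrow> mean w a l \<le> t \<longrightarrow>
    dyadic_energy w \<eta> k a l \<le> t powr \<eta> * mass w a l
      + C * (?D * t) powr \<eta> * (LINT x:stopping_set w t k a l|lebesgue. w x))" for k
  \<comment> \<open>the threshold 2 A turns S into P\<close>
  have SP: "P k" if "S k" for k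
    unfolding P_def
  proof (intro allI impI)
    fix a :: "real ^ 'n" and l :: real
    assume al: "0 < l" "hbox a l \<subseteq> hbox a0 l0"
    let ?A = "mean w a l"
    have A: "0 < ?A"
      using al(1) by (rule mean_pos)
    have "dyadic_energy w \<eta> k a l \<le> (2 * ?A) powr \<eta> * mass w a l
      + C * (?D * (2 * ?A)) powr \<eta> * (LINT x:stopping_set w (2 * ?A) k a l|lebesgue. w x)"
      using that[unfolded S_def, rule_format, OF al, of "2 * ?A"] A by simp
    also have "\<dots> \<le> (2 * ?A) powr \<eta> * mass w a l + C * (?D * (2 * ?A)) powr \<eta> * (\<beta> * mass w a l)"
      using stopping_set_light[OF al, of k] assms(1) by (intro add_left_mono mult_left_mono) auto
    also have "\<dots> = (2 powr \<eta> + C * (2 * ?D) powr \<eta> * \<beta>) * (?A powr \<eta> * mass w a l)"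
      using A by (simp add: powr_mult algebra_simps)
    also have "\<dots> \<le> C * (?A powr \<eta> * mass w a l)"
      using C mass_pos[OF al(1), of a] by (intro mult_right_mono) auto
    finally show "dyadic_energy w \<eta> k a l \<le> C * ?A powr \<eta> * mass w a l"
      by simp
  qed
  have "S k" for k
  proof (induction k)
    case 0
    show ?case
      unfolding S_def
    proof (intro allI impI)
      fix a :: "real ^ 'n" and l t :: real
      assume al: "0 < l" "hbox a l \<subseteq> hbox a0 l0" "mean w a l \<le> t"
      have "mean w a l powr \<eta> * mass w a l \<le> t powr \<eta> * mass w a l"
        using al assms(2) mean_pos[OF al(1), of a] mass_pos[OF al(1), of a]
        by (intro mult_right_mono powr_mono2) auto
      then show "dyadic_energy w \<eta> 0 a l \<le> t powr \<eta> * mass w a l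
        + C * (?D * t) powr \<eta> * (LINT x:stopping_set w t 0 a l|lebesgue. w x)"
        using al(3) by (simp add: set_lebesgue_integral_def)
    qed
  next
    case (Suc k)
    show ?case
      unfolding S_def
    proof (intro allI impI)
      fix a :: "real ^ 'n" and l t :: real
      assume al: "0 < l" "hbox a l \<subseteq> hbox a0 l0" "mean w a l \<le> t"
      have t: "0 < t"
        using al mean_pos[OF al(1), of a] by simp
      let ?c = "\<lambda>I. child a l I" and ?W = "\<lambda>I. LINT x:stopping_set w t k (child a l I) (l / 2)|lebesgue. w x"
      have child: "dyadic_energy w \<eta> k (?c I) (l / 2)
        \<le> t powr \<eta> * mass w (?c I) (l / 2) + C * (?D * t) powr \<eta> * ?W I" for I
      proof (cases "mean w (?c I) (l / 2) \<le> t")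
        case True
        have "hbox (?c I) (l / 2) \<subseteq> hbox a0 l0"
          using child_subset[OF al(1), of a I] al(2) by blast
        then show ?thesis
          using Suc.IH[unfolded S_def, rule_format, of "l / 2" "?c I" t] True al(1) by simp
      next
        case False
        have h: "hbox (?c I) (l / 2) \<subseteq> hbox a0 l0"
          using child_subset[OF al(1), of a I] al(2) by blast
        have "mean w (?c I) (l / 2) \<le> ?D * t"
          using mean_child_le[OF al(1), of a I] al(3) by (smt (verit) mult_left_mono zero_le_power)
        then have "C * mean w (?c I) (l / 2) powr \<eta> * mass w (?c I) (l / 2)
          \<le> C * (?D * t) powr \<eta> * mass w (?c I) (l / 2)"
          using assms(1,2) al(1) mean_pos[of "l / 2" "?c I"] mass_pos[of "l / 2" "?c I"]
          by (intro mult_right_mono mult_left_mono powr_mono2) auto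
        moreover have "?W I = mass w (?c I) (l / 2)"
          using False by (cases k) (auto simp: mass_def)
        moreover have "0 \<le> t powr \<eta> * mass w (?c I) (l / 2)"
          using al(1) mass_pos[of "l / 2" "?c I"] by simp
        ultimately show ?thesis
          using SP[OF Suc.IH, unfolded P_def, rule_format, OF _ h] al(1) by simp
      qed
      have "dyadic_energy w \<eta> (Suc k) a l
        \<le> (\<Sum>I\<in>UNIV. t powr \<eta> * mass w (?c I) (l / 2) + C * (?D * t) powr \<eta> * ?W I)"
        using child by (simp add: sum_mono)
      also have "\<dots> = t powr \<eta> * mass w a l + C * (?D * t) powr \<eta> * (\<Sum>I\<in>UNIV. ?W I)"
        by (simp add: mass_split[OF al(1)] sum.distrib sum_distrib_left)
      also have "(\<Sum>I\<in>UNIV. ?W I) = (LINT x:stopping_set w t (Suc k) a l|lebesgue. w x)"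
        using integral_UN_stopping_set[OF al(1), of w B t k a] abs_w al(3) by simp
      finally show "dyadic_energy w \<eta> (Suc k) a l \<le> t powr \<eta> * mass w a l
        + C * (?D * t) powr \<eta> * (LINT x:stopping_set w t (Suc k) a l|lebesgue. w x)" .
    qed
  qed
  then show ?thesis
    using SP[unfolded P_def] assms(4,5) by blast
qed

end

section \<open>Passage from dyadic averages to the weight itself\<close>

text \<open>
The mean value theorem; the power function has derivative at most (1+\<eta>) B^\<eta> below B.
\<close>

lemma powr_Suc_lipschitz:
  fixes x y B \<eta> :: real
  assumes "0 < x" "x \<le> B" "0 < y" "0 \<le> \<eta>"
  shows "x powr (1 + \<eta>) \<le> y powr (1 + \<eta>) + (1 + \<eta>) * B powr \<eta> * \<bar>x - y\<bar>"
proof (cases "y < x")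
  case True
  have "\<exists>z. y < z \<and> z < x \<and> x powr (1 + \<eta>) - y powr (1 + \<eta>) = (x - y) * ((1 + \<eta>) * z powr \<eta>)"
  proof (rule MVT2[OF True])
    fix z assume "y \<le> z" "z \<le> x"
    then show "((\<lambda>z. z powr (1 + \<eta>)) has_real_derivative (1 + \<eta>) * z powr \<eta>) (at z)"
      using has_real_derivative_powr[of z "1 + \<eta>"] assms by simp
  qed
  then obtain z where z: "y < z" "z < x"
    "x powr (1 + \<eta>) - y powr (1 + \<eta>) = (x - y) * ((1 + \<eta>) * z powr \<eta>)"
    by blast
  have "(x - y) * ((1 + \<eta>) * z powr \<eta>) \<le> (x - y) * ((1 + \<eta>) * B powr \<eta>)"
    using z True assms by (intro mult_left_mono powr_mono2) auto
  then show ?thesis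
    using z(3) True by (simp add: algebra_simps)
next
  case False
  then have "x powr (1 + \<eta>) \<le> y powr (1 + \<eta>)"
    using assms by (intro powr_mono2) auto
  moreover have "0 \<le> (1 + \<eta>) * B powr \<eta> * \<bar>x - y\<bar>"
    using assms by simp
  ultimately show ?thesis
    by linarith
qed

context bounded_weight
begin

lemma w_powr_le: "0 \<le> \<eta> \<Longrightarrow> w x powr (1 + \<eta>) \<le> B powr (1 + \<eta>)"
  using m_pos m_le[of x] w_le[of x] by (intro powr_mono2) auto

lemma abs_diff_le: "(\<And>x. \<bar>g x\<bar> \<le> B) \<Longrightarrow> \<bar>\<bar>w x - g x\<bar>\<bar> \<le> B + B"
  using abs_w[of x] by (smt (verit))

text \<open>
The dyadic energy misses at most the oscillation of w inside the cubes of generation k. If w is compared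
with a function g that oscillates by at most e on these cubes, the L1 distance of w from its dyadic mean
is at most twice that of w from a constant value of g.
\<close>

lemma integral_powr_le_dyadic_energy:
  fixes g :: "real ^ 'n \<Rightarrow> real"
  assumes \<eta>: "0 \<le> \<eta>"
    and g [measurable]: "g \<in> borel_measurable lebesgue" and g_le: "\<And>x. \<bar>g x\<bar> \<le> B"
    and osc: "\<And>a l x. 0 < l \<Longrightarrow> l \<le> \<delta> \<Longrightarrow> hbox a l \<subseteq> hbox a0 l0 \<Longrightarrow> x \<in> hbox a l \<Longrightarrow> \<bar>g x - g a\<bar> \<le> e"
    and "0 < l" "l / 2 ^ k \<le> \<delta>" "hbox a l \<subseteq> hbox a0 l0"
  shows "(LINT x:hbox a l|lebesgue. w x powr (1 + \<eta>))
    \<le> dyadic_energy w \<eta> k a l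
      + 2 * ((1 + \<eta>) * B powr \<eta>) * ((LINT x:hbox a l|lebesgue. \<bar>w x - g x\<bar>) + e * l ^ CARD('n))"
  using assms(5-7)
proof (induction k arbitrary: a l)
  case 0
  note l = 0(1)
  let ?H = "hbox a l" and ?A = "mean w a l" and ?L = "(1 + \<eta>) * B powr \<eta>"
  have L: "0 \<le> ?L"
    using \<eta> by simp
  have B: "0 < B"
    using m_pos m_le[of 0] w_le[of 0] by simp
  have A: "0 < ?A"
    using l by (rule mean_pos)
  have mass: "mass w a l = ?A * l ^ CARD('n)"
    using l by (simp add: mean_def)
  have wpos: "0 < w x" for x
    using m_pos m_le[of x] by simp
  have bounded_int: "set_integrable lebesgue ?H h" if "h \<in> borel_measurable lebesgue" "\<And>x. \<bar>h x\<bar> \<le> b"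
    for h :: "real ^ 'n \<Rightarrow> real" and b
    using that l by (intro set_integrable_bounded[where B = b]) auto
  have wc_int: "set_integrable lebesgue ?H (\<lambda>x. \<bar>w x - c\<bar>)" for c
    by (rule bounded_int[where b = "B + \<bar>c\<bar>"]) (use abs_w in \<open>auto intro: order_trans[OF abs_triangle_ineq4]\<close>)
  have wg_int: "set_integrable lebesgue ?H (\<lambda>x. \<bar>w x - g x\<bar>)"
    by (rule bounded_int[where b = "B + B"])
      (use abs_diff_le[OF g_le] in auto)
  have wp_int: "set_integrable lebesgue ?H (\<lambda>x. w x powr (1 + \<eta>))"
    by (rule bounded_int[where b = "B powr (1 + \<eta>)"])
      (use w_powr_le[OF \<eta>] in auto)
  have const_int: "set_integrable lebesgue ?H (\<lambda>x. c)" for c :: real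
    using l by (intro set_integrable_const_within) auto
  have "(LINT x:?H|lebesgue. \<bar>w x - ?A\<bar>) \<le> (LINT x:?H|lebesgue. \<bar>w x - g a\<bar> + \<bar>g a - ?A\<bar>)"
    by (intro set_integral_mono wc_int set_integral_add const_int) auto
  also have "\<dots> = (LINT x:?H|lebesgue. \<bar>w x - g a\<bar>) + \<bar>g a - ?A\<bar> * l ^ CARD('n)"
    using l by (simp add: set_integral_add wc_int const_int set_integral_const_hbox)
  also have "\<bar>g a - ?A\<bar> * l ^ CARD('n) = \<bar>LINT x:?H|lebesgue. w x - g a\<bar>"
  proof -
    have "(LINT x:?H|lebesgue. w x - g a) = (?A - g a) * l ^ CARD('n)"
      using l mass integrable_w[of ?H a l]
      by (simp add: set_integral_diff const_int set_integral_const_hbox mass_def[of w, symmetric] algebra_simps)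
    then show ?thesis
      using l by (simp add: abs_mult abs_minus_commute)
  qed
  also have "\<bar>LINT x:?H|lebesgue. w x - g a\<bar> \<le> (LINT x:?H|lebesgue. \<bar>w x - g a\<bar>)"
    using set_integral_norm_bound[of lebesgue ?H "\<lambda>x. w x - g a"] l
      integrable_w[of ?H a l] by (simp add: set_integral_diff const_int)
  also have "(LINT x:?H|lebesgue. \<bar>w x - g a\<bar>) \<le> (LINT x:?H|lebesgue. \<bar>w x - g x\<bar> + e)"
  proof (intro set_integral_mono wc_int set_integral_add wg_int const_int)
    fix x assume "x \<in> ?H"
    then show "\<bar>w x - g a\<bar> \<le> \<bar>w x - g x\<bar> + e"
      using osc[of l a x] 0 by force
  qed
  also have "\<dots> = (LINT x:?H|lebesgue. \<bar>w x - g x\<bar>) + e * l ^ CARD('n)"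
    using l by (simp add: set_integral_add wg_int const_int set_integral_const_hbox)
  finally have dev: "(LINT x:?H|lebesgue. \<bar>w x - ?A\<bar>)
    \<le> 2 * ((LINT x:?H|lebesgue. \<bar>w x - g x\<bar>) + e * l ^ CARD('n))"
    by simp
  have "(LINT x:?H|lebesgue. w x powr (1 + \<eta>))
    \<le> (LINT x:?H|lebesgue. ?A powr (1 + \<eta>) + ?L * \<bar>w x - ?A\<bar>)"
    using powr_Suc_lipschitz[OF wpos w_le A \<eta>]
    by (intro set_integral_mono wp_int set_integral_add const_int set_integrable_mult_right wc_int) auto
  also have "\<dots> = ?A powr (1 + \<eta>) * l ^ CARD('n) + ?L * (LINT x:?H|lebesgue. \<bar>w x - ?A\<bar>)"
    using l wc_int by (subst set_integral_add) (auto simp: const_int set_integral_const_hbox)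
  also have "?A powr (1 + \<eta>) * l ^ CARD('n) = dyadic_energy w \<eta> 0 a l"
    using A by (simp add: mass powr_add)
  also have "?L * (LINT x:?H|lebesgue. \<bar>w x - ?A\<bar>)
    \<le> ?L * (2 * ((LINT x:?H|lebesgue. \<bar>w x - g x\<bar>) + e * l ^ CARD('n)))"
    using dev L by (rule mult_left_mono)
  also have "\<dots> = 2 * ?L * ((LINT x:?H|lebesgue. \<bar>w x - g x\<bar>) + e * l ^ CARD('n))"
    by (simp only: mult_ac)
  finally show ?case
    by simp
next
  case (Suc k)
  let ?c = "\<lambda>I. child a l I" and ?L = "2 * ((1 + \<eta>) * B powr \<eta>)"
  note l = Suc.prems(1)
  have IH: "(LINT x:hbox (?c I) (l / 2)|lebesgue. w x powr (1 + \<eta>))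
    \<le> dyadic_energy w \<eta> k (?c I) (l / 2)
      + ?L * ((LINT x:hbox (?c I) (l / 2)|lebesgue. \<bar>w x - g x\<bar>) + e * (l / 2) ^ CARD('n))" for I
    using child_subset[OF l, of a I] Suc.prems by (intro Suc.IH) auto
  have "(LINT x:hbox a l|lebesgue. w x powr (1 + \<eta>))
    = (\<Sum>I\<in>UNIV. LINT x:hbox (?c I) (l / 2)|lebesgue. w x powr (1 + \<eta>))"
    by (rule set_integral_hbox_split[OF l, where B = "B powr (1 + \<eta>)"])
      (use w_powr_le[OF \<eta>] in auto)
  also have "\<dots> \<le> (\<Sum>I\<in>UNIV. dyadic_energy w \<eta> k (?c I) (l / 2)
      + ?L * ((LINT x:hbox (?c I) (l / 2)|lebesgue. \<bar>w x - g x\<bar>) + e * (l / 2) ^ CARD('n)))"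
    by (intro sum_mono IH)
  also have "\<dots> = dyadic_energy w \<eta> (Suc k) a l
    + ?L * ((\<Sum>I\<in>UNIV. LINT x:hbox (?c I) (l / 2)|lebesgue. \<bar>w x - g x\<bar>)
      + real (CARD('n set)) * (e * (l / 2) ^ CARD('n)))"
    by (simp add: sum.distrib flip: sum_distrib_left)
  also have "real (CARD('n set)) * (e * (l / 2) ^ CARD('n)) = e * l ^ CARD('n)"
    by (simp add: card_UNIV_set power_divide)
  also have "(\<Sum>I\<in>UNIV. LINT x:hbox (?c I) (l / 2)|lebesgue. \<bar>w x - g x\<bar>)
    = (LINT x:hbox a l|lebesgue. \<bar>w x - g x\<bar>)"
    by (rule set_integral_hbox_split[OF l, where B = "B + B", symmetric])
      (use abs_diff_le[OF g_le] in auto)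
  finally show ?case .
qed

text \<open>
Density of the continuous functions in L1 for a bounded weight: truncate continuous functions that
converge to w almost everywhere at height B and use dominated convergence.
\<close>

lemma continuous_approx:
  assumes "0 < l" "0 < e"
  obtains g where "continuous_on UNIV g" "\<And>x. \<bar>g x\<bar> \<le> B"
    "(LINT x:hbox a l|lebesgue. \<bar>w x - g x\<bar>) \<le> e"
proof -
  have "w measurable_on UNIV"
    by (rule lebesgue_measurable_imp_measurable_on) auto
  then obtain N h where N: "negligible N" and h: "\<And>n. continuous_on UNIV (h n)"
    and lim: "\<And>x. x \<notin> N \<Longrightarrow> (\<lambda>n. h n x) \<longlonglongrightarrow> w x"
    unfolding measurable_on_def by auto
  have B: "0 < B"
    using m_pos m_le[of 0] w_le[of 0] by simp
  define g where "g n x = max (- B) (min B (h n x))" for n :: nat and x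
  have g_le: "\<bar>g n x\<bar> \<le> B" for n x
    using B by (auto simp: g_def)
  have g: "continuous_on UNIV (g n)" for n
    unfolding g_def by (intro continuous_intros h)
  have gm [measurable]: "g n \<in> borel_measurable lebesgue" for n
    using borel_measurable_continuous_onI[OF g] by (intro measurable_completion) simp
  have "(\<lambda>n. LINT x|lebesgue. indicator (hbox a l) x *\<^sub>R \<bar>w x - g n x\<bar>)
    \<longlonglongrightarrow> (LINT x|(lebesgue :: (real ^ 'n) measure). (0 :: real))"
  proof (rule integral_dominated_convergence[where w = "\<lambda>x. indicator (hbox a l) x *\<^sub>R (B + B)"])
    show "integrable lebesgue (\<lambda>x. indicator (hbox a l) x *\<^sub>R (B + B))"
      using set_integrable_const_within[of "hbox a l" a l "B + B"] assms(1) by (simp add: set_integrable_def)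
    show "AE x in lebesgue. (\<lambda>n. indicator (hbox a l) x *\<^sub>R \<bar>w x - g n x\<bar>) \<longlonglongrightarrow> 0"
    proof (rule AE_I'[of N])
      show "N \<in> null_sets lebesgue"
        using N by (simp add: negligible_iff_null_sets)
      have "(\<lambda>n. indicator (hbox a l) x *\<^sub>R \<bar>w x - g n x\<bar>) \<longlonglongrightarrow> 0" if "x \<notin> N" for x
      proof -
        have "(\<lambda>n. indicator (hbox a l) x *\<^sub>R \<bar>w x - g n x\<bar>)
          \<longlonglongrightarrow> indicator (hbox a l) x *\<^sub>R \<bar>w x - max (- B) (min B (w x))\<bar>"
          unfolding g_def using lim[OF that] by (intro tendsto_intros)
        moreover have "max (- B) (min B (w x)) = w x"
          using abs_w[of x] by simp
        ultimately show ?thesis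
          by simp
      qed
      then show "{x \<in> space lebesgue. \<not> (\<lambda>n. indicator (hbox a l) x *\<^sub>R \<bar>w x - g n x\<bar>) \<longlonglongrightarrow> 0} \<subseteq> N"
        by blast
    qed
    show "AE x in lebesgue. norm (indicator (hbox a l) x *\<^sub>R \<bar>w x - g n x\<bar>)
      \<le> indicator (hbox a l) x *\<^sub>R (B + B)" for n
      using abs_diff_le[OF g_le[of n]] by (intro AE_I2) (auto split: split_indicator)
  qed auto
  then have "(\<lambda>n. LINT x:hbox a l|lebesgue. \<bar>w x - g n x\<bar>) \<longlonglongrightarrow> 0"
    by (simp add: set_lebesgue_integral_def)
  then have "\<forall>\<^sub>F n in sequentially. (LINT x:hbox a l|lebesgue. \<bar>w x - g n x\<bar>) < e"
    using assms(2) by (rule order_tendstoD)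
  then obtain n where "(LINT x:hbox a l|lebesgue. \<bar>w x - g n x\<bar>) < e"
    by (auto dest: eventually_happens)
  then show ?thesis
    using that[of "g n"] g g_le by simp
qed

end

text \<open>
The dyadic bound does not depend on the generation, and a continuous approximation of w oscillates
arbitrarily little on the cubes of a late generation.
\<close>

theorem (in A_infinity_weight) reverse_holder:
  fixes C \<eta> :: real
  assumes "0 \<le> C" "0 \<le> \<eta>" and C: "2 powr \<eta> + C * (2 * 2 ^ CARD('n)) powr \<eta> * \<beta> \<le> C"
    and "0 < l0"
  shows "(LINT x:hbox a0 l0|lebesgue. w x powr (1 + \<eta>)) \<le> C * mean w a0 l0 powr \<eta> * mass w a0 l0"
proof (rule field_le_epsilon)
  fix e :: real assume e: "0 < e"
  let ?L = "2 * ((1 + \<eta>) * B powr \<eta>)"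
  define \<epsilon> where "\<epsilon> = e / ((?L + 1) * (1 + l0 ^ CARD('n)))"
  have L: "0 \<le> ?L"
    using assms by simp
  have den: "0 < (?L + 1) * (1 + l0 ^ CARD('n))"
    using L assms(4) by (intro mult_pos_pos add_nonneg_pos add_pos_pos) auto
  then have \<epsilon>: "0 < \<epsilon>"
    using e by (simp add: \<epsilon>_def)
  obtain g where g: "continuous_on UNIV g" "\<And>x. \<bar>g x\<bar> \<le> B"
    and wg: "(LINT x:hbox a0 l0|lebesgue. \<bar>w x - g x\<bar>) \<le> \<epsilon>"
    using continuous_approx[OF assms(4) \<epsilon>] by blast
  let ?K = "cbox a0 (\<chi> i. a0 $ i + l0)"
  have "uniformly_continuous_on ?K g"
    using g(1) by (intro compact_uniformly_continuous) (auto intro: continuous_on_subset)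
  then obtain d where d: "0 < d"
    "\<And>x y. x \<in> ?K \<Longrightarrow> y \<in> ?K \<Longrightarrow> dist y x < d \<Longrightarrow> dist (g y) (g x) < \<epsilon>"
    unfolding uniformly_continuous_on_def using \<epsilon> by meson
  define \<delta> where "\<delta> = d / (1 + real CARD('n))"
  have osc: "\<bar>g x - g a\<bar> \<le> \<epsilon>"
    if "0 < l" "l \<le> \<delta>" and sub: "hbox a l \<subseteq> hbox a0 l0" and x: "x \<in> hbox a l" for a l x
  proof -
    have aH: "a \<in> hbox a l"
      using that(1) by (simp add: hbox_def)
    have inK: "y \<in> ?K" if "y \<in> hbox a0 l0" for y
      using that by (auto simp: hbox_def mem_box_cart less_imp_le)
    have "dist x a \<le> (\<Sum>i\<in>UNIV. \<bar>(x - a) $ i\<bar>)"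
      unfolding dist_norm by (rule norm_le_l1_cart)
    also have "\<dots> \<le> (\<Sum>i\<in>(UNIV :: 'n set). l)"
    proof (rule sum_mono)
      fix i
      show "\<bar>(x - a) $ i\<bar> \<le> l"
        using x by (auto simp: hbox_def abs_le_iff dest: spec[of _ i])
    qed
    also have "\<dots> \<le> real CARD('n) * \<delta>"
      using that(2) by (simp add: mult_left_mono)
    also have "\<dots> < d"
      using d(1) by (simp add: \<delta>_def field_simps)
    finally show ?thesis
      using d(2)[OF inK[OF subsetD[OF sub aH]] inK[OF subsetD[OF sub x]]]
      by (simp add: dist_real_def less_imp_le)
  qed
  have \<delta>: "0 < \<delta>"
    using d(1) by (simp add: \<delta>_def add_pos_nonneg)
  have "(\<lambda>k. l0 / 2 ^ k) \<longlonglongrightarrow> 0"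
    using LIMSEQ_divide_realpow_zero[of 2 l0] by simp
  then have "\<forall>\<^sub>F k in sequentially. l0 / 2 ^ k < \<delta>"
    using \<delta> by (rule order_tendstoD)
  then obtain k where k: "l0 / 2 ^ k < \<delta>"
    by (auto dest: eventually_happens)
  have "(LINT x:hbox a0 l0|lebesgue. w x powr (1 + \<eta>))
    \<le> dyadic_energy w \<eta> k a0 l0 + ?L * ((LINT x:hbox a0 l0|lebesgue. \<bar>w x - g x\<bar>) + \<epsilon> * l0 ^ CARD('n))"
    using assms(2,4) k g measurable_completion[of g lborel borel] borel_measurable_continuous_onI[OF g(1)]
    by (intro integral_powr_le_dyadic_energy[where a0 = a0 and ?l0.0 = l0 and \<delta> = \<delta>] osc) auto
  also have "\<dots> \<le> C * mean w a0 l0 powr \<eta> * mass w a0 l0 + ?L * (\<epsilon> + \<epsilon> * l0 ^ CARD('n))"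
    using dyadic_reverse_holder[OF assms(1-3) assms(4) order_refl, of k]
      mult_left_mono[OF add_right_mono[OF wg] L, of "\<epsilon> * l0 ^ CARD('n)"]
    by (rule add_mono)
  also have "?L * (\<epsilon> + \<epsilon> * l0 ^ CARD('n)) = ?L * (1 + l0 ^ CARD('n)) * \<epsilon>"
    by (simp add: algebra_simps)
  also have "\<dots> \<le> (?L + 1) * (1 + l0 ^ CARD('n)) * \<epsilon>"
    using \<epsilon> assms(4) by (intro mult_right_mono) auto
  also have "\<dots> = e"
    unfolding \<epsilon>_def times_divide_eq_right using den by (intro nonzero_mult_div_cancel_left) linarith
  finally show "(LINT x:hbox a0 l0|lebesgue. w x powr (1 + \<eta>))
    \<le> C * mean w a0 l0 powr \<eta> * mass w a0 l0 + e"
    by simp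
qed

section \<open>Weights generated by an exponent of class A\<close>

text \<open>
Class A for cubes of volume at most 1, expressed by levels: T and S are the reciprocals of the norms of the
indicator of the cube for q and its conjugate exponent. In this form the symmetry under conjugation is
visible, and the weights are bounded functions.
\<close>

definition A_condition :: "(real ^ 'n \<Rightarrow> real) \<Rightarrow> real \<Rightarrow> bool" where
  "A_condition q K \<longleftrightarrow> (\<forall>a l. 0 < l \<longrightarrow> l \<le> 1 \<longrightarrow> (\<exists>T S. 1 \<le> T \<and> 1 \<le> S \<and>
    (LINT x:hbox a l|lebesgue. T powr q x) = 1 \<and>
    (LINT x:hbox a l|lebesgue. S powr (q x / (q x - 1))) = 1 \<and>
    1 \<le> K * l ^ CARD('n) * T * S))"

lemma A_condition_conjugate:
  fixes q :: "real ^ 'n \<Rightarrow> real"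
  assumes "A_condition q K" "\<And>x. 1 < q x"
  shows "A_condition (\<lambda>x. q x / (q x - 1)) K"
proof -
  have "q x / (q x - 1) / (q x / (q x - 1) - 1) = q x" for x
    using assms(2)[of x] by (simp add: field_simps)
  note conj = this
  show ?thesis
    unfolding A_condition_def conj
  proof (intro allI impI)
    fix a :: "real ^ 'n" and l :: real
    assume "0 < l" "l \<le> 1"
    then obtain T S where "1 \<le> T" "1 \<le> S" "(LINT x:hbox a l|lebesgue. T powr q x) = 1"
      "(LINT x:hbox a l|lebesgue. S powr (q x / (q x - 1))) = 1" "1 \<le> K * l ^ CARD('n) * T * S"
      using assms(1) unfolding A_condition_def by blast
    then show "\<exists>T S. 1 \<le> T \<and> 1 \<le> S \<and> (LINT x:hbox a l|lebesgue. T powr (q x / (q x - 1))) = 1 \<and>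
      (LINT x:hbox a l|lebesgue. S powr q x) = 1 \<and> 1 \<le> K * l ^ CARD('n) * T * S"
      by (intro exI[of _ S] exI[of _ T]) (simp add: mult_ac)
  qed
qed

text \<open>
With r = q/(q-1) the left-hand side equals (T v)^{-r} v, and class A bounds 1/(T v) by K S.
\<close>

lemma dual_weight_le:
  fixes T S K v q :: real
  assumes "0 < T" "0 < S" "0 < K" "0 < v" "1 < q" "1 \<le> K * v * T * S"
  shows "(T powr q * v) powr - (1 / (q - 1)) \<le> K powr (q / (q - 1)) * (S powr (q / (q - 1)) * v)"
proof -
  define r where "r = q / (q - 1)"
  have r: "- (1 / (q - 1)) = - r + 1" "q * (- r + 1) = - r" "0 < r"
    using assms by (auto simp: r_def field_simps)
  have "(T powr q * v) powr - (1 / (q - 1)) = T powr - r * v powr (- r + 1)"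
    unfolding r(1) using assms by (simp only: powr_mult powr_powr r(2))
  also have "\<dots> = (T * v) powr - r * v"
    using assms powr_add[of v "- r" 1] by (simp add: powr_mult)
  finally have "(T powr q * v) powr - (1 / (q - 1)) = (T * v) powr - r * v" .
  also have "(T * v) powr - r = (1 / (T * v)) powr r"
    using assms by (simp add: powr_minus powr_divide field_simps)
  also have "\<dots> \<le> (K * S) powr r"
    using assms r by (intro powr_mono2) (auto simp: field_simps)
  finally show ?thesis
    using assms by (simp add: powr_mult r_def mult_ac)
qed

text \<open>
Some \<eta> > 0 makes D^\<eta> \<beta> smaller than the midpoint \<gamma> of \<beta> and 1; then C solves
a geometric series with ratio \<gamma>.
\<close>

lemma exists_reverse_holder_constants:
  fixes D \<beta> :: real
  assumes "1 < D" "0 \<le> \<beta>" "\<beta> < 1"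
  obtains \<eta> C :: real where "0 < \<eta>" "0 < C" "2 powr \<eta> + C * D powr \<eta> * \<beta> \<le> C"
proof -
  define \<gamma> where "\<gamma> = (1 + \<beta>) / 2"
  have \<gamma>: "\<beta> < \<gamma>" "\<gamma> < 1" "0 < \<gamma>"
    using assms by (auto simp: \<gamma>_def)
  have "((\<lambda>\<eta>. D powr \<eta> * \<beta>) \<longlongrightarrow> D powr 0 * \<beta>) (at_right 0)"
    using assms by (intro tendsto_intros) auto
  then have "\<forall>\<^sub>F \<eta> in at_right 0. D powr \<eta> * \<beta> < \<gamma>"
    using \<gamma> assms by (auto intro: order_tendstoD)
  then have "\<forall>\<^sub>F \<eta> in at_right 0. D powr \<eta> * \<beta> < \<gamma> \<and> 0 < \<eta>"
    by (auto intro: eventually_conj eventually_at_right_less)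
  then obtain \<eta> where \<eta>: "D powr \<eta> * \<beta> < \<gamma>" "0 < \<eta>"
    using eventually_happens'[OF trivial_limit_at_right_real] by blast
  define C where "C = 2 powr \<eta> / (1 - \<gamma>)"
  have C: "0 < C"
    using \<gamma> by (simp add: C_def)
  have "C * (D powr \<eta> * \<beta>) \<le> C * \<gamma>"
    using \<eta> C by (intro mult_left_mono) auto
  moreover have "2 powr \<eta> = C * (1 - \<gamma>)"
    using \<gamma> by (simp add: C_def)
  ultimately have "2 powr \<eta> + C * D powr \<eta> * \<beta> \<le> C"
    by (simp add: algebra_simps)
  then show ?thesis
    using that \<eta> C by blast
qed

lemma powr_le_one_plus:
  fixes u \<theta> :: real
  assumes "0 < u" "0 \<le> \<theta>" "\<theta> \<le> 1"
  shows "u powr \<theta> \<le> 1 + u"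
proof (cases "u \<le> 1")
  case True
  then have "u powr \<theta> \<le> 1"
    using assms by (simp add: powr_le1)
  then show ?thesis
    using assms by simp
next
  case False
  then have "u powr \<theta> \<le> u powr 1"
    using assms by (intro powr_mono) auto
  then show ?thesis
    using assms by simp
qed

locale exponent =
  fixes q :: "real ^ 'n \<Rightarrow> real" and \<alpha> \<beta> K :: real
  assumes measurable_q [measurable]: "q \<in> borel_measurable lebesgue"
    and \<alpha>: "1 < \<alpha>" and q_ge: "\<And>x. \<alpha> \<le> q x" and q_le: "\<And>x. q x \<le> \<beta>"
    and K: "1 \<le> K" and A: "A_condition q K"
begin

lemma q_gt: "1 < q x"
  using \<alpha> q_ge[of x] by simp

lemma \<alpha>_le_\<beta>: "\<alpha> \<le> \<beta>"
  using q_ge q_le order_trans by blast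

lemma conj_le: "q x / (q x - 1) \<le> \<alpha> / (\<alpha> - 1)"
  using \<alpha> q_ge[of x] by (simp add: field_simps)

lemma powr_weight: "1 \<le> T \<Longrightarrow> bounded_weight (\<lambda>x. T powr q x) 1 (T powr \<beta>)"
proof unfold_locales
  fix x assume T: "1 \<le> T"
  show "1 \<le> T powr q x"
    using T q_gt[of x] by (intro ge_one_powr_ge_zero) auto
  show "T powr q x \<le> T powr \<beta>"
    using T q_le by (intro powr_mono) auto
qed auto

text \<open>
The weight T^q v on the cube satisfies an A_q condition with variable q: its dual weight is dominated by a
multiple of S^{q'} v, whose integral is v.
\<close>

lemma exists_level_dual_bound:
  assumes "0 < l" "l \<le> 1"
  obtains T where "1 \<le> T" "(LINT x:hbox a l|lebesgue. T powr q x) = 1"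
    "set_integrable lebesgue (hbox a l) (\<lambda>x. (T powr q x * l ^ CARD('n)) powr - (1 / (q x - 1)))"
    "(LINT x:hbox a l|lebesgue. (T powr q x * l ^ CARD('n)) powr - (1 / (q x - 1)))
      \<le> K powr (\<alpha> / (\<alpha> - 1)) * l ^ CARD('n)"
proof -
  let ?H = "hbox a l" and ?v = "l ^ CARD('n)" and ?r = "\<lambda>x. q x / (q x - 1)"
  obtain T S where TS: "1 \<le> T" "1 \<le> S" "(LINT x:?H|lebesgue. T powr q x) = 1"
    "(LINT x:?H|lebesgue. S powr ?r x) = 1" "1 \<le> K * ?v * T * S"
    using A assms unfolding A_condition_def by blast
  let ?\<sigma> = "\<lambda>x. (T powr q x * ?v) powr - (1 / (q x - 1))"
  let ?k = "K powr (\<alpha> / (\<alpha> - 1))"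
  have v: "0 < ?v"
    using assms by simp
  have le: "?\<sigma> x \<le> ?k * (S powr ?r x * ?v)" for x
  proof -
    have "?\<sigma> x \<le> K powr ?r x * (S powr ?r x * ?v)"
      using TS v K q_gt by (intro dual_weight_le) auto
    also have "\<dots> \<le> ?k * (S powr ?r x * ?v)"
      using v K conj_le[of x] by (intro mult_right_mono powr_mono) auto
    finally show ?thesis .
  qed
  have r_le: "S powr ?r x \<le> S powr (\<alpha> / (\<alpha> - 1))" for x
    using TS conj_le by (intro powr_mono) auto
  have S_int: "set_integrable lebesgue ?H (\<lambda>x. S powr ?r x)"
    using assms r_le by (intro set_integrable_bounded[where B = "S powr (\<alpha> / (\<alpha> - 1))"]) auto
  then have kS_int: "set_integrable lebesgue ?H (\<lambda>x. ?k * (S powr ?r x * ?v))"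
    by (intro set_integrable_mult_right set_integrable_mult_left)
  have \<sigma>_int: "set_integrable lebesgue ?H ?\<sigma>"
    by (rule set_integrable_bound[OF kS_int])
       (use le K in \<open>auto simp: set_borel_measurable_def intro!: AE_I2 intro: order_trans[OF _ abs_ge_self]\<close>)
  have "(LINT x:?H|lebesgue. ?\<sigma> x) \<le> (LINT x:?H|lebesgue. ?k * (S powr ?r x * ?v))"
    using le by (intro set_integral_mono \<sigma>_int kS_int)
  also have "\<dots> = ?k * ?v"
    using TS(4) by simp
  finally show ?thesis
    using that TS \<sigma>_int by blast
qed

text \<open>
If T were smaller than T0, then replacing T by T0 would raise the integral over the smaller cube above 1.
\<close>

lemma level_mono:
  assumes "0 < l" "0 < l0" "hbox a l \<subseteq> hbox a0 l0" "1 \<le> T" "1 \<le> T0"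
    and T: "(LINT x:hbox a l|lebesgue. T powr q x) = 1"
    and T0: "(LINT x:hbox a0 l0|lebesgue. T0 powr q x) = 1"
  shows "T0 \<le> T"
proof (rule ccontr)
  assume "\<not> T0 \<le> T"
  then have less: "T < T0"
    by simp
  interpret W: bounded_weight "\<lambda>x. T powr q x" 1 "T powr \<beta>"
    using assms by (intro powr_weight)
  interpret W0: bounded_weight "\<lambda>x. T0 powr q x" 1 "T0 powr \<beta>"
    using assms by (intro powr_weight)
  have le: "T0 / T * T powr q x \<le> T0 powr q x" for x
  proof -
    have "T0 / T = (T0 / T) powr 1"
      using assms less by simp
    also have "\<dots> \<le> (T0 / T) powr q x"
      using assms less q_gt[of x] by (intro powr_mono) auto
    finally show ?thesis
      using assms by (simp add: powr_divide field_simps)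
  qed
  have "1 < T0 / T"
    using less assms by simp
  also have "\<dots> = (LINT x:hbox a l|lebesgue. T0 / T * T powr q x)"
    using T by simp
  also have "\<dots> \<le> (LINT x:hbox a l|lebesgue. T0 powr q x)"
    using assms by (intro set_integral_mono le set_integrable_mult_right W.integrable_w W0.integrable_w) auto
  also have "\<dots> \<le> (LINT x:hbox a0 l0|lebesgue. T0 powr q x)"
    unfolding set_lebesgue_integral_def
    using W0.integrable_w[of "hbox a l" a l] W0.integrable_w[of "hbox a0 l0" a0 l0] assms
    by (intro integral_mono) (auto simp: set_integrable_def split: split_indicator)
  finally show False
    using T0 by simp
qed

text \<open>
On a cube R of volume v inside the large one, T0^q equals v^{-\<theta>} u^\<theta> for the normalized weight
u of R and some \<theta> in [0,1]. Where u is at least a small number \<rho>, so is u^\<theta>; where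
u < \<rho>, the dual weight is large, and this happens on a small part of R only. Hence a set that fills at
least half of R carries a fixed fraction of the mass, and its complement cannot carry more than the rest.
\<close>

lemma A_infinity_level:
  assumes "0 < l0" "l0 \<le> 1" "1 \<le> T0" and T0: "(LINT x:hbox a0 l0|lebesgue. T0 powr q x) = 1"
  shows "A_infinity_weight (\<lambda>x. T0 powr q x) 1 (T0 powr \<beta>) a0 l0
    (1 - (4 * K powr (\<alpha> / (\<alpha> - 1))) powr - (\<beta> - 1) / 8)"
proof -
  interpret W0: bounded_weight "\<lambda>x. T0 powr q x" 1 "T0 powr \<beta>"
    using assms by (intro powr_weight)
  let ?k = "K powr (\<alpha> / (\<alpha> - 1))"
  \<comment> \<open>the choice for which the dual weight, scaled so that it is at least 1 where u <
    \<rho>, has integral at most v / 4\<close>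
  define \<rho> where "\<rho> = (4 * ?k) powr - (\<beta> - 1)"
  have k: "1 \<le> ?k"
    using K \<alpha> by (simp add: ge_one_powr_ge_zero)
  have \<beta>: "1 < \<beta>"
    using \<alpha> \<alpha>_le_\<beta> by simp
  have \<rho>: "0 < \<rho>" "\<rho> \<le> 1" "\<rho> powr (1 / (\<beta> - 1)) = 1 / (4 * ?k)"
  proof -
    show "0 < \<rho>"
      using K by (simp add: \<rho>_def)
    have "(4 * ?k) powr - (\<beta> - 1) \<le> (4 * ?k) powr 0"
      using k \<beta> by (intro powr_mono) auto
    then show "\<rho> \<le> 1"
      using K by (simp add: \<rho>_def)
    have e: "- (\<beta> - 1) * (1 / (\<beta> - 1)) = -1"
      using \<beta> by (simp add: field_simps)
    have "\<rho> powr (1 / (\<beta> - 1)) = (4 * ?k) powr -1"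
      unfolding \<rho>_def powr_powr e ..
    then show "\<rho> powr (1 / (\<beta> - 1)) = 1 / (4 * ?k)"
      using k by (simp add: powr_minus field_simps)
  qed
  show ?thesis
  proof (unfold_locales, fold \<rho>_def)
    fix a :: "real ^ 'n" and l :: real and E
    assume l: "0 < l" and sub: "hbox a l \<subseteq> hbox a0 l0" and E [measurable]: "E \<in> sets lebesgue"
      and EH: "E \<subseteq> hbox a l" and small: "measure lebesgue E \<le> measure lebesgue (hbox a l) / 2"
    let ?H = "hbox a l" and ?v = "l ^ CARD('n)"
    have v: "0 < ?v"
      using l by simp
    have "emeasure lebesgue ?H \<le> emeasure lebesgue (hbox a0 l0)"
      using sub by (intro emeasure_mono) auto
    then have "?v \<le> l0 ^ CARD('n)"
      using l assms by (simp add: emeasure_hbox del: emeasure_completion)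
    also have "\<dots> \<le> 1"
      using assms by (simp add: power_le_one)
    finally have "l \<le> 1"
      using l by (meson not_le one_less_power zero_less_card_finite)
    then obtain T where T: "1 \<le> T" "(LINT x:?H|lebesgue. T powr q x) = 1"
      and \<sigma>_int: "set_integrable lebesgue ?H (\<lambda>x. (T powr q x * ?v) powr - (1 / (q x - 1)))"
      and \<sigma>: "(LINT x:?H|lebesgue. (T powr q x * ?v) powr - (1 / (q x - 1))) \<le> ?k * ?v"
      using exists_level_dual_bound[of l a] l by blast
    interpret W: bounded_weight "\<lambda>x. T powr q x" 1 "T powr \<beta>"
      using T by (intro powr_weight)
    have "T0 \<le> T"
      using level_mono l sub assms T by blast
    obtain \<theta> where \<theta>: "0 \<le> \<theta>" "\<theta> \<le> 1" "T0 = T powr \<theta>"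
    proof (cases "T = 1")
      case True
      then have "T0 = T powr 0"
        using \<open>T0 \<le> T\<close> assms by simp
      then show ?thesis
        using that[of 0] by simp
    next
      case False
      then have "T0 = T powr log T T0" "0 \<le> log T T0" "log T T0 \<le> 1"
        using \<open>T0 \<le> T\<close> assms T by auto
      then show ?thesis
        using that by blast
    qed
    define u where "u x = T powr q x * ?v" for x
    have u: "0 < u x" for x
      using T v by (simp add: u_def)
    have w_eq: "T0 powr q x = ?v powr - \<theta> * u x powr \<theta>" for x
    proof -
      have "?v powr - \<theta> * ?v powr \<theta> = 1"
        using l by (simp flip: powr_add)
      moreover have "u x powr \<theta> = T0 powr q x * ?v powr \<theta>"
        by (simp only: \<theta>(3) u_def powr_mult powr_powr mult.commute)
      ultimately show ?thesis
        by (simp add: mult.left_commute)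
    qed
    have u_int: "set_integrable lebesgue ?H u"
      unfolding u_def using l W.integrable_w[of ?H a l] by (intro set_integrable_mult_left) auto
    have c_int: "set_integrable lebesgue ?H (\<lambda>x. c)" for c :: real
      using l by (intro set_integrable_const_within) auto
    have "mass (\<lambda>x. T0 powr q x) a l \<le> (LINT x:?H|lebesgue. ?v powr - \<theta> * (1 + u x))"
      unfolding mass_def
      using l \<theta> powr_le_one_plus[OF u] v w_eq
      by (intro set_integral_mono W0.integrable_w set_integrable_mult_right set_integral_add c_int u_int)
         (auto intro!: mult_left_mono)
    also have "\<dots> = ?v powr - \<theta> * (2 * ?v)"
    proof -
      have "u = (\<lambda>x. T powr q x * ?v)"
        by (simp add: u_def fun_eq_iff)
      then have "(LINT x:?H|lebesgue. u x) = ?v"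
        using T(2) by simp
      then show ?thesis
        using l by (simp add: set_integral_add(2)[OF c_int u_int] set_integral_const_hbox)
    qed
    finally have mass_le: "mass (\<lambda>x. T0 powr q x) a l \<le> ?v powr - \<theta> * (2 * ?v)" .
    define G where "G = ?H - E"
    have G [measurable]: "G \<in> sets lebesgue" and GH: "G \<subseteq> ?H"
      by (auto simp: G_def)
    have meas_G: "?v / 2 \<le> measure lebesgue G"
    proof -
      have "measure lebesgue G = measure lebesgue ?H - measure lebesgue E"
        unfolding G_def using EH l by (intro measure_Diff) (auto simp: emeasure_hbox simp del: emeasure_completion)
      then show ?thesis
        using small l by (simp add: measure_hbox)
    qed
    define \<sigma> where "\<sigma> x = u x powr - (1 / (q x - 1))" for x
    have \<sigma>_H: "set_integrable lebesgue ?H \<sigma>" "(LINT x:?H|lebesgue. \<sigma> x) \<le> ?k * ?v"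
    proof -
      have eq: "\<sigma> = (\<lambda>x. (T powr q x * ?v) powr - (1 / (q x - 1)))"
        by (simp add: \<sigma>_def u_def fun_eq_iff)
      show "set_integrable lebesgue ?H \<sigma>" "(LINT x:?H|lebesgue. \<sigma> x) \<le> ?k * ?v"
        unfolding eq by (rule \<sigma>_int, rule \<sigma>)
    qed
    have \<sigma>_G: "set_integrable lebesgue G \<sigma>" "(LINT x:G|lebesgue. \<sigma> x) \<le> ?k * ?v"
    proof -
      show "set_integrable lebesgue G \<sigma>"
        using \<sigma>_H(1) G GH by (rule set_integrable_subset)
      then have "(LINT x:G|lebesgue. \<sigma> x) \<le> (LINT x:?H|lebesgue. \<sigma> x)"
        unfolding set_lebesgue_integral_def using \<sigma>_H(1) GH
        by (intro integral_mono) (auto simp: set_integrable_def \<sigma>_def split: split_indicator)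
      then show "(LINT x:G|lebesgue. \<sigma> x) \<le> ?k * ?v"
        using \<sigma>_H(2) by simp
    qed
    \<comment> \<open>a pointwise form of Chebyshev's inequality: the left-hand side is nonpositive
      where u < \<rho>\<close>
    have lower: "?v powr - \<theta> * (\<rho> * (1 - \<rho> powr (1 / (\<beta> - 1)) * \<sigma> x)) \<le> T0 powr q x" for x
    proof -
      have "\<rho> * (1 - \<rho> powr (1 / (\<beta> - 1)) * \<sigma> x) \<le> u x powr \<theta>"
      proof (cases "\<rho> \<le> u x")
        case True
        have "\<rho> * (1 - \<rho> powr (1 / (\<beta> - 1)) * \<sigma> x) \<le> \<rho> * 1"
          using \<rho> by (intro mult_left_mono) (auto simp: \<sigma>_def)
        also have "\<dots> \<le> \<rho> powr \<theta>"
          using \<rho> \<theta> powr_mono'[of \<theta> 1 \<rho>] by simp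
        also have "\<dots> \<le> u x powr \<theta>"
          using True \<rho> \<theta> by (intro powr_mono2) auto
        finally show ?thesis .
      next
        case False
        have "1 \<le> \<rho> powr (1 / (\<beta> - 1)) * \<sigma> x"
        proof -
          have "1 = u x powr (1 / (q x - 1)) * \<sigma> x"
            using u[of x] by (simp add: \<sigma>_def powr_minus)
          also have "u x powr (1 / (q x - 1)) \<le> \<rho> powr (1 / (q x - 1))"
            using False u[of x] q_gt[of x] by (intro powr_mono2) auto
          also have "\<rho> powr (1 / (q x - 1)) \<le> \<rho> powr (1 / (\<beta> - 1))"
            using \<rho> q_gt[of x] q_le[of x] by (intro powr_mono') (auto simp: frac_le)
          finally show ?thesis
            by (simp add: \<sigma>_def mult_right_mono)
        qed
        then have "\<rho> * (1 - \<rho> powr (1 / (\<beta> - 1)) * \<sigma> x) \<le> 0"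
          using \<rho> by (simp add: mult_nonneg_nonpos)
        also have "0 \<le> u x powr \<theta>"
          by simp
        finally show ?thesis .
      qed
      then show ?thesis
        unfolding w_eq by (intro mult_left_mono) auto
    qed
    have cG_int: "set_integrable lebesgue G (\<lambda>x. c)" for c :: real
      using set_integrable_const_within[OF G GH l] .
    have "?v powr - \<theta> * (\<rho> * (?v / 4)) \<le> ?v powr - \<theta> * (\<rho> * (measure lebesgue G - \<rho> powr (1 / (\<beta> - 1)) * (LINT x:G|lebesgue. \<sigma> x)))"
    proof -
      have "\<rho> powr (1 / (\<beta> - 1)) * (LINT x:G|lebesgue. \<sigma> x) \<le> 1 / (4 * ?k) * (?k * ?v)"
        unfolding \<rho>(3) using \<sigma>_G(2) k by (intro mult_left_mono) auto
      also have "\<dots> = ?v / 4"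
        using K by simp
      finally show ?thesis
        using meas_G \<rho> by (intro mult_left_mono) auto
    qed
    also have "\<dots> = (LINT x:G|lebesgue. ?v powr - \<theta> * (\<rho> * (1 - \<rho> powr (1 / (\<beta> - 1)) * \<sigma> x)))"
      using \<sigma>_G(1) by (simp add: set_integral_diff(2)[OF cG_int] set_integral_const_within[OF G GH l])
    also have "\<dots> \<le> (LINT x:G|lebesgue. T0 powr q x)"
      using lower
      by (intro set_integral_mono set_integrable_mult_right set_integral_diff(1) cG_int \<sigma>_G(1)
          W0.integrable_w[OF G GH l])
    finally have "\<rho> / 8 * (?v powr - \<theta> * (2 * ?v)) \<le> (LINT x:G|lebesgue. T0 powr q x)"
      by (simp add: field_simps)
    then have "\<rho> / 8 * mass (\<lambda>x. T0 powr q x) a l \<le> (LINT x:G|lebesgue. T0 powr q x)"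
      by (rule order_trans[rotated]) (use \<rho> mass_le in \<open>intro mult_left_mono, auto\<close>)
    moreover have "mass (\<lambda>x. T0 powr q x) a l = (LINT x:E|lebesgue. T0 powr q x) + (LINT x:G|lebesgue. T0 powr q x)"
    proof -
      have "?H = E \<union> G" "E \<inter> G = {}"
        using EH by (auto simp: G_def)
      then show ?thesis
        unfolding mass_def
        using set_integral_Un[of E G lebesgue] W0.integrable_w[OF G GH l] W0.integrable_w[OF E EH l] by simp
    qed
    ultimately show "(LINT x:E|lebesgue. T0 powr q x) \<le> (1 - \<rho> / 8) * mass (\<lambda>x. T0 powr q x) a l"
      by (simp add: algebra_simps)
  qed
qed

end

text \<open>
The constants depend on the bounds of the exponent, on K and on the dimension only, since the A-infinity
constant of the weights T^q does.
\<close>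

lemma level_reverse_holder:
  fixes \<alpha> \<beta> K :: real
  assumes "1 < \<alpha>" "\<alpha> \<le> \<beta>" "1 \<le> K"
  obtains \<eta> C :: real where "0 < \<eta>" "0 < C"
    "\<And>(q :: real ^ 'n \<Rightarrow> real) a l T. exponent q \<alpha> \<beta> K \<Longrightarrow> 0 < l \<Longrightarrow> l \<le> 1 \<Longrightarrow> 1 \<le> T \<Longrightarrow>
      (LINT x:hbox a l|lebesgue. T powr q x) = 1 \<Longrightarrow>
      (LINT x:hbox a l|lebesgue. (T powr q x * l ^ CARD('n)) powr (1 + \<eta>)) \<le> C * l ^ CARD('n)"
proof -
  let ?k = "K powr (\<alpha> / (\<alpha> - 1))" and ?D = "2 * 2 ^ CARD('n) :: real"
  define b where "b = 1 - (4 * ?k) powr - (\<beta> - 1) / 8"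
  have k: "1 \<le> ?k"
    using assms by (simp add: ge_one_powr_ge_zero)
  then have "0 < (4 * ?k) powr - (\<beta> - 1)" "(4 * ?k) powr - (\<beta> - 1) \<le> 1"
    using assms powr_mono[of "- (\<beta> - 1)" 0 "4 * ?k"] by auto
  then have b: "0 \<le> b" "b < 1"
    by (auto simp: b_def)
  have "1 \<le> (2 :: real) ^ CARD('n)"
    by simp
  then have D: "1 < ?D"
    by linarith
  obtain \<eta> C :: real where \<eta>: "0 < \<eta>" and C: "0 < C" "2 powr \<eta> + C * ?D powr \<eta> * b \<le> C"
    using exists_reverse_holder_constants[OF D b] by blast
  have "(LINT x:hbox a l|lebesgue. (T powr q x * l ^ CARD('n)) powr (1 + \<eta>)) \<le> C * l ^ CARD('n)"
    if "exponent q \<alpha> \<beta> K" and l: "0 < l" "l \<le> 1" and T: "1 \<le> T" "(LINT x:hbox a l|lebesgue. T powr q x) = 1"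
    for q :: "real ^ 'n \<Rightarrow> real" and a l T
  proof -
    interpret exponent q \<alpha> \<beta> K
      by fact
    interpret A_infinity_weight "\<lambda>x. T powr q x" 1 "T powr \<beta>" a l b
      unfolding b_def using l T by (rule A_infinity_level)
    let ?v = "l ^ CARD('n)"
    have v: "0 < ?v"
      using l by simp
    have mass: "mass (\<lambda>x. T powr q x) a l = 1"
      using T by (simp add: mass_def)
    have "(LINT x:hbox a l|lebesgue. (T powr q x) powr (1 + \<eta>)) \<le> C * (1 / ?v) powr \<eta>"
      using reverse_holder[of C \<eta>] C \<eta> l by (simp add: mean_def mass)
    then have "(LINT x:hbox a l|lebesgue. (T powr q x) powr (1 + \<eta>)) * ?v powr (1 + \<eta>)
      \<le> C * (1 / ?v) powr \<eta> * ?v powr (1 + \<eta>)"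
      by (intro mult_right_mono) auto
    also have "\<dots> = C * ?v"
      using v by (simp add: powr_divide powr_add)
    finally show ?thesis
      using v T by (simp add: powr_mult)
  qed
  then show ?thesis
    using that \<eta> C by blast
qed

section \<open>The averaged inequality on one cube\<close>

text \<open>
Young's inequality for the product of \<mu> h u^{x/r} and u^{-x/r} / \<mu>. The parameter \<mu> makes the second
summand small at the expense of the first.
\<close>

lemma young_split:
  fixes h u x \<mu> r :: real
  assumes "1 < r" "0 \<le> h" "0 < u" "1 \<le> \<mu>"
  shows "h \<le> \<mu> powr r * (h powr r * u powr x) + u powr - (x / (r - 1)) / \<mu>"
proof -
  define r' where "r' = r / (r - 1)"
  have r': "1 < r'" "1 / r + 1 / r' = 1" "x / r * r' = x / (r - 1)"
    using assms by (auto simp: r'_def field_simps)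
  let ?A = "\<mu> * h * u powr (x / r)" and ?B = "u powr - (x / r) / \<mu>"
  have "h = ?A * ?B"
    using assms by (simp add: powr_minus field_simps)
  also have "\<dots> \<le> ?A powr r / r + ?B powr r' / r'"
    using assms r' by (intro Youngs_inequality) auto
  also have "?A powr r / r \<le> ?A powr r"
    using assms by (simp add: divide_le_eq mult_le_cancel_left1)
  also have "?A powr r = \<mu> powr r * (h powr r * u powr x)"
    using assms by (simp add: powr_mult powr_powr)
  also have "?B powr r' / r' \<le> ?B powr r'"
    using r' by (simp add: divide_le_eq mult_le_cancel_left1)
  also have "?B powr r' = u powr - (x / (r - 1)) / \<mu> powr r'"
    using assms r' by (simp add: powr_divide powr_powr)
  also have "\<dots> \<le> u powr - (x / (r - 1)) / \<mu>"
    using assms r' powr_mono[of 1 r' \<mu>] by (intro divide_left_mono) auto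
  finally show ?thesis
    by simp
qed

lemma powr_between:
  fixes u x A B :: real
  assumes "0 < u" "- B \<le> x" "x \<le> A"
  shows "u powr x \<le> u powr A + u powr - B"
proof (cases "1 \<le> u")
  case True
  then have "u powr x \<le> u powr A"
    using assms by (intro powr_mono) auto
  then show ?thesis
    by (simp add: add_increasing2)
next
  case False
  then have "u powr x \<le> u powr - B"
    using assms by (intro powr_mono') auto
  then show ?thesis
    by (simp add: add_increasing)
qed

text \<open>
What the rest of the proof uses about a cube, seen as a probability space M: its volume v, its level T, and
the two moment bounds for the normalized weight u = T^p v. The bound on 1/v by a power of T holds because
T^p has mean 1/v.
\<close>

locale level_space =
  fixes M :: "'a measure" and p :: "'a \<Rightarrow> real" and T v \<alpha> \<beta> \<eta> C :: real
  assumes total: "emeasure M (space M) = 1"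
    and p_measurable [measurable]: "p \<in> borel_measurable M"
    and \<alpha>: "1 < \<alpha>" and p_ge: "\<And>x. \<alpha> \<le> p x" and p_le: "\<And>x. p x \<le> \<beta>"
    and T: "1 \<le> T" and v: "0 < v" and T_v: "1 \<le> T powr \<beta> * v" and \<eta>: "0 < \<eta>" and C: "1 \<le> C"
    and high: "(\<integral>\<^sup>+x. ennreal ((T powr p x * v) powr (1 + \<eta>)) \<partial>M) \<le> ennreal C"
    and low: "(\<integral>\<^sup>+x. ennreal ((T powr p x * v) powr - ((1 + \<eta>) / (p x - 1))) \<partial>M) \<le> ennreal C"
begin

definition u :: "'a \<Rightarrow> real" where
  "u x = T powr p x * v"

text \<open>
One integrable function that dominates all admissible powers of u.
\<close>

definition E :: "'a \<Rightarrow> real" where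
  "E x = u x powr (1 + \<eta>) + u x powr - ((1 + \<eta>) / (p x - 1))"

lemma u_measurable [measurable]: "u \<in> borel_measurable M"
  unfolding u_def by measurable

lemma E_measurable [measurable]: "E \<in> borel_measurable M"
  unfolding E_def by measurable

lemma u_pos: "0 < u x"
  using T v by (simp add: u_def)

lemma E_nonneg: "0 \<le> E x"
  by (simp add: E_def)

lemma p_gt: "1 < p x"
  using \<alpha> p_ge[of x] by simp

lemma \<beta>: "1 < \<beta>"
  using p_gt p_le less_le_trans by blast

lemma integral_E: "(\<integral>\<^sup>+x. ennreal (E x) \<partial>M) \<le> ennreal (2 * C)"
proof -
  have "(\<integral>\<^sup>+x. ennreal (E x) \<partial>M) = (\<integral>\<^sup>+x. ennreal (u x powr (1 + \<eta>)) \<partial>M)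
    + (\<integral>\<^sup>+x. ennreal (u x powr - ((1 + \<eta>) / (p x - 1))) \<partial>M)"
    unfolding E_def by (subst nn_integral_add[symmetric]) auto
  also have "\<dots> \<le> ennreal C + ennreal C"
    using high low unfolding u_def by (rule add_mono)
  also have "\<dots> = ennreal (2 * C)"
    using C by (simp flip: ennreal_plus)
  finally show ?thesis .
qed

lemma u_powr_le: "- ((1 + \<eta>) / (p x - 1)) \<le> y \<Longrightarrow> y \<le> 1 + \<eta> \<Longrightarrow> u x powr y \<le> E x"
  unfolding E_def using u_pos by (intro powr_between)

end

text \<open>
The conditions on s0 and a say exactly that all powers of u that occur below are dominated by E:
they are u^{\<theta> s}, u^{-1/(q-1)} and u^{-(\<theta>/s)/(q-1)} with q = p/s, s in [1,s0] and
\<theta> in [-a,s].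
\<close>

locale admissible_scale = level_space +
  fixes s0 a :: real
  assumes s0: "1 < s0" "s0 ^ 2 \<le> 1 + \<eta>" "s0 * (\<alpha> + \<eta>) \<le> \<alpha> * (1 + \<eta>)"
    and a: "0 < a" "a * s0 * (\<beta> - 1) \<le> 1" "a \<le> \<alpha> / s0 - 1"
begin

lemma scaled_exponent:
  assumes "1 \<le> s" "s \<le> s0"
  shows "a \<le> p x / s - 1" "1 < p x / s" "1 / (p x / s - 1) \<le> (1 + \<eta>) / (p x - 1)"
proof -
  have "\<alpha> / s0 \<le> p x / s"
    using assms \<alpha> p_ge[of x] by (intro frac_le) auto
  then show 1: "a \<le> p x / s - 1"
    using a(3) by simp
  then show 2: "1 < p x / s"
    using a(1) by simp
  \<comment> \<open>the last claim amounts to s (p - 1) \<le> (1 + \<eta>) (p - s), whose difference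
    increases with p, so p = \<alpha> is the worst case\<close>
  have "s0 * s0 \<le> (1 + \<eta>) * s0"
  proof (rule mult_right_mono)
    show "s0 \<le> 1 + \<eta>"
      using s0 by (smt (verit) power2_eq_square mult_le_cancel_left1)
  qed (use s0 in simp)
  then have "s0 \<le> 1 + \<eta>"
    using s0 by simp
  then have "\<alpha> * (1 + \<eta> - s) \<le> p x * (1 + \<eta> - s)"
    using assms p_ge by (intro mult_right_mono) auto
  moreover have "s * (\<alpha> + \<eta>) \<le> s0 * (\<alpha> + \<eta>)"
    using assms \<alpha> \<eta> by (intro mult_right_mono) auto
  ultimately have "s * (p x - 1) \<le> (1 + \<eta>) * (p x - s)"
    using s0(3) by (simp add: algebra_simps)
  then show "1 / (p x / s - 1) \<le> (1 + \<eta>) / (p x - 1)"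
    using 2 assms p_gt[of x] by (simp add: field_simps)
qed

text \<open>
For h = |g| / (2 T^s) and q = p/s the powers of T cancel in h^q u, which leaves the integrand of the modular.
Young's inequality bounds h by h^q u + u^{-1/(q-1)}, and E dominates the second summand.
\<close>

lemma mean_le_level:
  assumes s: "1 \<le> s" "s \<le> s0" and g [measurable]: "g \<in> borel_measurable M"
    and le: "(\<integral>\<^sup>+x. ennreal ((\<bar>g x\<bar> / 2) powr (p x / s) * v) \<partial>M) \<le> 1"
  shows "(\<integral>\<^sup>+x. ennreal \<bar>g x\<bar> \<partial>M) \<le> ennreal (2 * (1 + 2 * C) * T powr s)"
proof -
  have pt: "\<bar>g x\<bar> \<le> 2 * T powr s * ((\<bar>g x\<bar> / 2) powr (p x / s) * v + E x)" for x
  proof -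
    define h where "h = \<bar>g x\<bar> / (2 * T powr s)"
    let ?q = "p x / s"
    have h: "0 \<le> h"
      by (simp add: h_def)
    have "h \<le> h powr ?q * u x powr 1 + u x powr - (1 / (?q - 1))"
      using young_split[of ?q h "u x" 1 1] scaled_exponent(2)[OF s] u_pos h by simp
    also have "u x powr - (1 / (?q - 1)) \<le> E x"
      using scaled_exponent(2,3)[OF s, of x] \<eta> by (intro u_powr_le) (auto intro: order_trans[of _ 0])
    also have "h powr ?q * u x powr 1 = (\<bar>g x\<bar> / 2) powr ?q * v"
    proof -
      have "h = \<bar>g x\<bar> / 2 / T powr s"
        by (simp add: h_def)
      then have "h powr ?q = (\<bar>g x\<bar> / 2) powr ?q / T powr p x"
        using s by (simp only: powr_divide powr_powr) simp
      then show ?thesis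
        using T u_pos[of x] by (simp add: u_def)
    qed
    finally have "h \<le> (\<bar>g x\<bar> / 2) powr ?q * v + E x"
      by simp
    then show ?thesis
      using T by (simp add: h_def field_simps)
  qed
  have "(\<integral>\<^sup>+x. ennreal \<bar>g x\<bar> \<partial>M)
    \<le> (\<integral>\<^sup>+x. ennreal (2 * T powr s) * (ennreal ((\<bar>g x\<bar> / 2) powr (p x / s) * v) + ennreal (E x)) \<partial>M)"
    using pt v E_nonneg by (intro nn_integral_mono) (simp flip: ennreal_plus ennreal_mult)
  also have "\<dots> = ennreal (2 * T powr s) * ((\<integral>\<^sup>+x. ennreal ((\<bar>g x\<bar> / 2) powr (p x / s) * v) \<partial>M)
    + (\<integral>\<^sup>+x. ennreal (E x) \<partial>M))"
    by (simp add: nn_integral_cmult nn_integral_add)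
  also have "\<dots> \<le> ennreal (2 * T powr s) * (1 + ennreal (2 * C))"
    using le integral_E by (intro mult_left_mono add_mono) auto
  also have "\<dots> = ennreal (2 * (1 + 2 * C) * T powr s)"
    using C by (simp add: mult_ac flip: ennreal_plus ennreal_mult ennreal_1)
  finally show ?thesis .
qed

text \<open>
For h = |f|/t and q = p/s, Young's inequality bounds h by \<mu>^q h^q u^{\<theta>/s} + E/\<mu>. The mean of h
is 1 and that of E is at most 2C, so \<mu> = 4C leaves at least 1/2 for the first summand. Since
t is at least T^\<theta>, the integrand h^q u^{\<theta>/s} is at most v^{\<theta>/s} |f|^q.
\<close>

lemma modular_lower_bound:
  assumes s: "1 \<le> s" "s \<le> s0" and \<theta>: "- a \<le> \<theta>" "\<theta> \<le> s"
    and f [measurable]: "f \<in> borel_measurable M"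
    and t: "(\<integral>\<^sup>+x. ennreal \<bar>f x\<bar> \<partial>M) = ennreal t" "T powr \<theta> \<le> t"
    and X: "(\<integral>\<^sup>+x. ennreal (\<bar>f x\<bar> powr (p x / s)) \<partial>M) = ennreal X" "0 \<le> X"
  shows "v powr - \<theta> \<le> (2 * (4 * C) powr \<beta>) powr s0 * X powr s"
proof -
  let ?\<mu> = "4 * C" and ?k = "2 * (4 * C) powr \<beta>"
  have t_pos: "0 < t"
    using t(2) T by (smt (verit) powr_gt_zero)
  have pt: "\<bar>f x\<bar> \<le> t * (?\<mu> powr \<beta> * v powr (\<theta> / s) * \<bar>f x\<bar> powr (p x / s) + E x / ?\<mu>)" for x
  proof -
    define h where "h = \<bar>f x\<bar> / t"
    let ?q = "p x / s"
    have h: "0 \<le> h"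
      using t_pos by (simp add: h_def)
    have q: "a \<le> ?q - 1" "1 < ?q" "1 / (?q - 1) \<le> (1 + \<eta>) / (p x - 1)"
      using scaled_exponent[OF s] by auto
    have q_le: "?q \<le> \<beta>"
    proof -
      have "p x * 1 \<le> \<beta> * s"
        using p_le[of x] p_gt[of x] s by (intro mult_mono) auto
      then show ?thesis
        using s by (simp add: divide_le_eq)
    qed
    have "h \<le> ?\<mu> powr ?q * (h powr ?q * u x powr (\<theta> / s)) + u x powr - (\<theta> / s / (?q - 1)) / ?\<mu>"
      using q h u_pos C by (intro young_split) auto
    also have "u x powr - (\<theta> / s / (?q - 1)) / ?\<mu> \<le> E x / ?\<mu>"
    proof (intro divide_right_mono u_powr_le)
      have "\<theta> / s \<le> 1"
        using \<theta> s by simp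
      then have "\<theta> / s / (?q - 1) \<le> 1 / (?q - 1)"
        using q by (intro divide_right_mono) auto
      then show "- ((1 + \<eta>) / (p x - 1)) \<le> - (\<theta> / s / (?q - 1))"
        using q(3) by simp
      have "- (\<theta> / s) \<le> a"
      proof -
        have "a * 1 \<le> a * s"
          using s a(1) by (intro mult_left_mono) auto
        then have "- \<theta> \<le> a * s"
          using \<theta> by simp
        then show ?thesis
          unfolding minus_divide_left using s by (subst divide_le_eq) auto
      qed
      then have "- (\<theta> / s) \<le> 1 * (?q - 1)"
        unfolding mult_1 using q(1) by (rule order_trans)
      then have "- (\<theta> / s) / (?q - 1) \<le> 1"
        using q by (subst pos_divide_le_eq) auto
      then have "- (\<theta> / s / (?q - 1)) \<le> 1"
        by (simp only: minus_divide_left)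
      then show "- (\<theta> / s / (?q - 1)) \<le> 1 + \<eta>"
        using \<eta> by simp
    qed (use C in simp)
    also have "?\<mu> powr ?q * (h powr ?q * u x powr (\<theta> / s))
      \<le> ?\<mu> powr \<beta> * (v powr (\<theta> / s) * \<bar>f x\<bar> powr ?q)"
    proof (rule mult_mono)
      show "?\<mu> powr ?q \<le> ?\<mu> powr \<beta>"
        using C q_le by (intro powr_mono) auto
      have "h powr ?q * u x powr (\<theta> / s) = (T powr \<theta> / t) powr ?q * (v powr (\<theta> / s) * \<bar>f x\<bar> powr ?q)"
        by (simp add: h_def u_def powr_divide powr_mult powr_powr mult_ac)
      also have "\<dots> \<le> 1 * (v powr (\<theta> / s) * \<bar>f x\<bar> powr ?q)"
        using t t_pos q T by (intro mult_right_mono powr_le1) auto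
      finally show "h powr ?q * u x powr (\<theta> / s) \<le> v powr (\<theta> / s) * \<bar>f x\<bar> powr ?q"
        by simp
    qed auto
    finally show ?thesis
      using t_pos by (simp add: h_def field_simps)
  qed
  define r where "r = 1 / ?\<mu> * (2 * C)"
  have r_eq: "r = 1 / 2" and r: "0 \<le> r"
    using C by (auto simp: r_def)
  have "ennreal t = (\<integral>\<^sup>+x. ennreal \<bar>f x\<bar> \<partial>M)"
    by (rule t(1)[symmetric])
  also have "\<dots> \<le> (\<integral>\<^sup>+x. ennreal t * (ennreal (?\<mu> powr \<beta> * v powr (\<theta> / s)) * ennreal (\<bar>f x\<bar> powr (p x / s))
    + ennreal (1 / ?\<mu>) * ennreal (E x)) \<partial>M)"
    using pt v E_nonneg C t_pos
    by (intro nn_integral_mono) (simp flip: ennreal_plus ennreal_mult)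
  also have "\<dots> = ennreal t * (ennreal (?\<mu> powr \<beta> * v powr (\<theta> / s)) * ennreal X
    + ennreal (1 / ?\<mu>) * (\<integral>\<^sup>+x. ennreal (E x) \<partial>M))"
    by (simp add: nn_integral_cmult nn_integral_add X(1))
  also have "\<dots> \<le> ennreal t * (ennreal (?\<mu> powr \<beta> * v powr (\<theta> / s)) * ennreal X
    + ennreal (1 / ?\<mu>) * ennreal (2 * C))"
    using integral_E by (intro mult_left_mono add_mono) auto
  also have "ennreal (1 / ?\<mu>) * ennreal (2 * C) = ennreal r"
    using C by (subst ennreal_mult[symmetric]) (auto simp: r_def)
  also have "ennreal t * (ennreal (?\<mu> powr \<beta> * v powr (\<theta> / s)) * ennreal X + ennreal r)
    = ennreal (t * (?\<mu> powr \<beta> * v powr (\<theta> / s) * X + r))"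
    using r X(2) t_pos by (simp flip: ennreal_plus ennreal_mult)
  finally have "t \<le> t * (?\<mu> powr \<beta> * v powr (\<theta> / s) * X + r)"
    using t_pos r X(2) by (subst (asm) ennreal_le_iff) auto
  then have "1 \<le> ?\<mu> powr \<beta> * v powr (\<theta> / s) * X + r"
    using t_pos by simp
  then have "1 \<le> ?k * X * v powr (\<theta> / s)"
    by (simp add: r_eq field_simps)
  then have "v powr - (\<theta> / s) \<le> ?k * X"
    using v by (simp add: powr_minus field_simps)
  then have "(v powr - (\<theta> / s)) powr s \<le> (?k * X) powr s"
    using s by (intro powr_mono2) auto
  also have "\<dots> = ?k powr s * X powr s"
    by (simp add: powr_mult)
  also have "\<dots> \<le> ?k powr s0 * X powr s"
  proof (intro mult_right_mono powr_mono)
    have "1 \<le> (4 * C) powr \<beta>"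
      using C \<beta> by (intro ge_one_powr_ge_zero) auto
    then show "1 \<le> ?k"
      by simp
  qed (use s in auto)
  finally show ?thesis
    using s by (simp add: powr_powr)
qed

text \<open>
For t above T^s the exponent s serves, with the ratio absorbed by C0; below it the logarithm of t does.
\<close>

lemma level_representation:
  assumes "1 \<le> C0" "1 \<le> s" "T powr - a < t" "t \<le> C0 * T powr s"
  obtains \<theta> where "- a \<le> \<theta>" "\<theta> \<le> s" "T powr \<theta> \<le> t" "t \<le> C0 * T powr \<theta>"
proof (cases "T powr s \<le> t")
  case True
  then show ?thesis
    using that[of s] assms a by auto
next
  case False
  then have "T \<noteq> 1"
    using assms by auto
  then have "1 < T"
    using T by simp
  have "0 < t"
    using assms(3) by (smt (verit) powr_ge_zero)
  have "- a < log T t" "log T t < s" "T powr log T t = t"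
    using assms False \<open>1 < T\<close> \<open>0 < t\<close> by (auto simp: less_log_iff log_less_iff)
  then show ?thesis
    using that[of "log T t"] assms \<open>0 < t\<close> by auto
qed

text \<open>
Here t \<le> 1, so t^{s p} is at most t^s, and T^{-a} is at most v^{a/\<beta>}.
\<close>

lemma small_mean:
  assumes "1 \<le> s" "0 \<le> t" "t \<le> T powr - a"
    and L: "(\<integral>\<^sup>+x. ennreal (t powr (s * p x)) \<partial>M) = ennreal L" "0 \<le> L"
  shows "L powr (1 / s) \<le> v powr (a / \<beta>)"
proof -
  have t: "t \<le> 1"
    using assms(3) T a powr_mono[of "- a" 0 T] by auto
  have "ennreal L \<le> (\<integral>\<^sup>+x. ennreal (t powr s) \<partial>M)"
    unfolding L(1)[symmetric] using assms t p_gt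
    by (intro nn_integral_mono ennreal_leI powr_mono') (auto simp: less_imp_le)
  then have "L \<le> t powr s"
    using total by simp
  then have "L powr (1 / s) \<le> (t powr s) powr (1 / s)"
    using assms by (intro powr_mono2) auto
  also have "\<dots> = t"
    using assms by (simp add: powr_powr)
  also have "t \<le> T powr - a"
    by fact
  also have "\<dots> = (T powr \<beta>) powr - (a / \<beta>)"
    using \<beta> by (simp add: powr_powr)
  also have "\<dots> \<le> (1 / v) powr - (a / \<beta>)"
    using T_v v a \<beta> T by (intro powr_mono2') (auto simp: field_simps)
  also have "\<dots> = v powr (a / \<beta>)"
    using v by (simp add: powr_divide powr_minus)
  finally show ?thesis .
qed

text \<open>
The power T^{\<theta> s p} equals v^{-\<theta> s} u^{\<theta> s}, whose last factor is dominated by E.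
\<close>

lemma mean_powr_upper_bound:
  assumes s: "1 \<le> s" "s \<le> s0" and \<theta>: "- a \<le> \<theta>" "\<theta> \<le> s" and C0: "1 \<le> C0"
    and t: "0 \<le> t" "t \<le> C0 * T powr \<theta>"
    and L: "(\<integral>\<^sup>+x. ennreal (t powr (s * p x)) \<partial>M) = ennreal L" "0 \<le> L"
  shows "L powr (1 / s) \<le> C0 powr \<beta> * (2 * C) * v powr - \<theta>"
proof -
  have pt: "t powr (s * p x) \<le> C0 powr (s * \<beta>) * v powr - (\<theta> * s) * E x" for x
  proof -
    have "t powr (s * p x) \<le> (C0 * T powr \<theta>) powr (s * p x)"
      using t s p_gt[of x] by (intro powr_mono2) auto
    also have "\<dots> = C0 powr (s * p x) * (v powr - (\<theta> * s) * u x powr (\<theta> * s))"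
      using v by (simp add: u_def powr_mult powr_powr powr_minus mult_ac)
    also have "\<dots> \<le> C0 powr (s * \<beta>) * (v powr - (\<theta> * s) * E x)"
    proof (intro mult_mono mult_left_mono u_powr_le)
      show "C0 powr (s * p x) \<le> C0 powr (s * \<beta>)"
        using C0 s p_le by (intro powr_mono mult_left_mono) auto
      have "a * s \<le> a * s0"
        using a s by (intro mult_left_mono) auto
      then have "a * s * (p x - 1) \<le> a * s0 * (\<beta> - 1)"
        using a s p_le[of x] p_gt[of x] by (intro mult_mono) auto
      then have "a * s * (p x - 1) \<le> 1 + \<eta>"
        using a(2) \<eta> by simp
      then have "a * s \<le> (1 + \<eta>) / (p x - 1)"
        using p_gt[of x] by (simp add: field_simps)
      moreover have "- a * s \<le> \<theta> * s"
        using \<theta> s by (intro mult_right_mono) auto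
      ultimately show "- ((1 + \<eta>) / (p x - 1)) \<le> \<theta> * s"
        by simp
      have "\<theta> * s \<le> s0 * s0"
        using \<theta> s by (intro mult_mono) auto
      then show "\<theta> * s \<le> 1 + \<eta>"
        using s0(2) by (simp add: power2_eq_square)
    qed auto
    finally show ?thesis
      by (simp add: mult_ac)
  qed
  have "ennreal L \<le> (\<integral>\<^sup>+x. ennreal (C0 powr (s * \<beta>) * v powr - (\<theta> * s)) * ennreal (E x) \<partial>M)"
    unfolding L(1)[symmetric] using pt E_nonneg by (intro nn_integral_mono) (simp flip: ennreal_mult)
  also have "\<dots> = ennreal (C0 powr (s * \<beta>) * v powr - (\<theta> * s)) * (\<integral>\<^sup>+x. ennreal (E x) \<partial>M)"
    by (simp add: nn_integral_cmult)
  also have "\<dots> \<le> ennreal (C0 powr (s * \<beta>) * v powr - (\<theta> * s)) * ennreal (2 * C)"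
    using integral_E by (rule mult_left_mono) simp
  also have "\<dots> = ennreal (C0 powr (s * \<beta>) * v powr - (\<theta> * s) * (2 * C))"
    using C by (simp flip: ennreal_mult)
  finally have "L \<le> C0 powr (s * \<beta>) * v powr - (\<theta> * s) * (2 * C)"
    using C by (subst (asm) ennreal_le_iff) auto
  then have "L powr (1 / s) \<le> (C0 powr (s * \<beta>) * v powr - (\<theta> * s) * (2 * C)) powr (1 / s)"
    using s L by (intro powr_mono2) auto
  also have "\<dots> = C0 powr \<beta> * v powr - \<theta> * (2 * C) powr (1 / s)"
    using s by (simp only: powr_mult powr_powr) (simp add: field_simps)
  also have "\<dots> \<le> C0 powr \<beta> * v powr - \<theta> * (2 * C) powr 1"
    using s C by (intro mult_left_mono powr_mono) auto
  finally show ?thesis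
    using C by (simp add: mult_ac)
qed

theorem mean_modular_estimate:
  assumes s: "1 \<le> s" "s \<le> s0" and C0: "1 \<le> C0"
    and f [measurable]: "f \<in> borel_measurable M"
    and t: "(\<integral>\<^sup>+x. ennreal \<bar>f x\<bar> \<partial>M) = ennreal t" "0 \<le> t" "t \<le> C0 * T powr s"
    and X: "(\<integral>\<^sup>+x. ennreal (\<bar>f x\<bar> powr (p x / s)) \<partial>M) = ennreal X" "0 \<le> X"
    and L: "(\<integral>\<^sup>+x. ennreal (t powr (s * p x)) \<partial>M) = ennreal L" "0 \<le> L"
  shows "L powr (1 / s) \<le> C0 powr \<beta> * (2 * C) * (2 * (4 * C) powr \<beta>) powr s0 * X powr s + v powr (a / \<beta>)"
proof (cases "t \<le> T powr - a")
  case True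
  then have "L powr (1 / s) \<le> v powr (a / \<beta>)"
    using small_mean s t L by blast
  moreover have "0 \<le> C0 powr \<beta> * (2 * C) * (2 * (4 * C) powr \<beta>) powr s0 * X powr s"
    using C by simp
  ultimately show ?thesis
    by linarith
next
  case False
  then obtain \<theta> where \<theta>: "- a \<le> \<theta>" "\<theta> \<le> s" "T powr \<theta> \<le> t" "t \<le> C0 * T powr \<theta>"
    using level_representation[OF C0 s(1) _ t(3)] by auto
  have "L powr (1 / s) \<le> C0 powr \<beta> * (2 * C) * v powr - \<theta>"
    using mean_powr_upper_bound s \<theta> C0 t L by blast
  also have "\<dots> \<le> C0 powr \<beta> * (2 * C) * ((2 * (4 * C) powr \<beta>) powr s0 * X powr s)"
    using modular_lower_bound[OF s \<theta>(1,2) f t(1) \<theta>(3) X] C by (intro mult_left_mono) auto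
  finally show ?thesis
    by (simp add: mult_ac add_increasing2)
qed

end

section \<open>From norms to levels\<close>

lemma epow_mono: "t \<le> t' \<Longrightarrow> 0 \<le> q \<Longrightarrow> epow t q \<le> epow t' q"
proof -
  assume le: "t \<le> t'" and q: "0 \<le> q"
  show ?thesis
  proof (cases "q = \<infinity> \<or> t' = \<infinity>")
    case True
    then show ?thesis
      using le by (auto simp: epow_def top_unique)
  next
    case False
    then have "enn2real t \<le> enn2real t'"
      using le by (intro enn2real_mono) (auto simp: less_top)
    then have "enn2real t powr real_of_ereal q \<le> enn2real t' powr real_of_ereal q"
      using q by (intro powr_mono2) (auto simp: real_of_ereal_pos)
    then show ?thesis
      using False le by (auto simp: epow_def top_unique ennreal_leI)
  qed
qed

lemma epow_ennreal: "0 \<le> t \<Longrightarrow> epow (ennreal t) (ereal r) = ennreal (t powr r)"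
  by (simp add: epow_def)

lemma conj_exponent_ereal: "1 < r \<Longrightarrow> p x = ereal r \<Longrightarrow> conj_exponent p x = ereal (r / (r - 1))"
  by (simp add: conj_exponent_def one_ereal_def field_simps)

text \<open>
The number 2 stands for any bound above the norm; it avoids the question whether the infimum in the norm is
attained.
\<close>

lemma modular_two_le_one:
  assumes "vnorm q f < 2" "\<And>x. 0 \<le> q x"
  shows "(\<integral>\<^sup>+x. epow (ennreal (\<bar>f x\<bar> / 2)) (q x) \<partial>lebesgue) \<le> 1"
proof -
  obtain t where t: "0 < t" "ennreal t < 2"
    "(\<integral>\<^sup>+x. epow (ennreal (\<bar>f x\<bar> / t)) (q x) \<partial>lebesgue) \<le> 1"
    using assms(1) unfolding vnorm_def Inf_less_iff by auto
  have "t < 2"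
    using t(1,2) by (simp add: ennreal_less_numeral_iff)
  then have "(\<integral>\<^sup>+x. epow (ennreal (\<bar>f x\<bar> / 2)) (q x) \<partial>lebesgue)
    \<le> (\<integral>\<^sup>+x. epow (ennreal (\<bar>f x\<bar> / t)) (q x) \<partial>lebesgue)"
    using t(1) assms(2) by (intro nn_integral_mono epow_mono ennreal_leI frac_le) auto
  then show ?thesis
    using t(3) by simp
qed

lemma nn_integral_cube:
  fixes a :: "real ^ 'n" and F :: "real ^ 'n \<Rightarrow> real"
  assumes "0 < l" "set_integrable lebesgue (hbox a l) F" "\<And>x. 0 \<le> F x"
  shows "(\<integral>\<^sup>+x. ennreal (F x) * indicator (cbox a (\<chi> i. a $ i + l)) x \<partial>lebesgue)
    = ennreal (LINT x:hbox a l|lebesgue. F x)"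
proof -
  have "(\<integral>\<^sup>+x. ennreal (F x) * indicator (cbox a (\<chi> i. a $ i + l)) x \<partial>lebesgue)
    = (\<integral>\<^sup>+x. ennreal (indicator (hbox a l) x *\<^sub>R F x) \<partial>lebesgue)"
    using hbox_AE_eq_cube[OF assms(1), of a]
    by (intro nn_integral_cong_AE) (auto split: split_indicator elim!: eventually_mono)
  also have "\<dots> = ennreal (LINT x:hbox a l|lebesgue. F x)"
    unfolding set_lebesgue_integral_def
    using assms by (intro nn_integral_eq_integral) (auto simp: set_integrable_def)
  finally show ?thesis .
qed

text \<open>
The integral \<phi>(T) of T^q over the cube is at most 1 for T = 1 and at least 1 for T = 1/v, and it is
Lipschitz in between, so it takes the value 1. It grows at least linearly, hence the admissible numbers
in the norm of the indicator are exactly those from 1/T on.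
\<close>

lemma level_exists:
  fixes q :: "real ^ 'n \<Rightarrow> real" and a :: "real ^ 'n"
  assumes q [measurable]: "q \<in> borel_measurable lebesgue" "\<And>x. 1 < q x" "\<And>x. q x \<le> \<beta>"
    and l: "0 < l" "l \<le> 1"
  obtains T where "1 \<le> T" "(LINT x:hbox a l|lebesgue. T powr q x) = 1"
    "\<And>p. (\<And>x. p x = ereal (q x)) \<Longrightarrow>
      vnorm p (indicator (cbox a (\<chi> i. a $ i + l))) = ennreal (1 / T)"
proof -
  let ?H = "hbox a l" and ?v = "l ^ CARD('n)"
  define \<phi> where "\<phi> T = (LINT x:?H|lebesgue. T powr q x)" for T
  have v: "0 < ?v" "?v \<le> 1"
    using l by (auto simp: power_le_one)
  have int: "set_integrable lebesgue ?H (\<lambda>x. T powr q x)" if "0 < T" for T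
  proof (rule set_integrable_bounded[where B = "max 1 T powr \<beta>"])
    fix x
    have "T powr q x \<le> max 1 T powr q x"
      using that q(2)[of x] by (intro powr_mono2) auto
    also have "\<dots> \<le> max 1 T powr \<beta>"
      using q(3) by (intro powr_mono) auto
    finally show "\<bar>T powr q x\<bar> \<le> max 1 T powr \<beta>"
      by simp
  qed (use l in auto)
  have const_int: "set_integrable lebesgue ?H (\<lambda>x. c)" for c :: real
    using l by (intro set_integrable_const_within) auto
  have const: "(LINT x:?H|lebesgue. c) = c * ?v" for c :: real
    using l by (simp add: set_integral_const_hbox)
  have scale: "c * \<phi> T \<le> \<phi> (c * T)" if "1 \<le> c" "0 < T" for c T
  proof -
    have "c * T powr q x \<le> (c * T) powr q x" for x
      using that q(2)[of x] powr_mono[of 1 "q x" c] by (simp add: powr_mult mult_right_mono)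
    then have "(LINT x:?H|lebesgue. c * T powr q x) \<le> (LINT x:?H|lebesgue. (c * T) powr q x)"
      using that by (intro set_integral_mono set_integrable_mult_right int) auto
    then show ?thesis
      by (simp add: \<phi>_def)
  qed
  have mono: "\<phi> T \<le> \<phi> T'" if "0 < T" "T \<le> T'" for T T'
    unfolding \<phi>_def using that q(2) less_imp_le[OF less_trans[OF zero_less_one q(2)]]
    by (intro set_integral_mono int powr_mono2) auto
  have \<phi>1: "\<phi> 1 = ?v"
    using const[of 1] by (simp add: \<phi>_def)
  have "continuous_on {1..1 / ?v} \<phi>"
  proof (rule lipschitz_on_continuous_on)
    let ?B = "1 / ?v"
    let ?L = "\<beta> * ?B powr \<beta> * ?v"
    have B: "1 \<le> ?B"
      using v by simp
    have \<beta>: "0 < \<beta>"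
      using q(2,3)[of 0] by simp
    have le: "\<phi> x \<le> \<phi> y + ?L * \<bar>x - y\<bar>" if xy: "x \<in> {1..?B}" "y \<in> {1..?B}" for x y
    proof -
      have "x powr q z \<le> y powr q z + \<beta> * ?B powr \<beta> * \<bar>x - y\<bar>" for z
      proof -
        have "x powr (1 + (q z - 1)) \<le> y powr (1 + (q z - 1)) + (1 + (q z - 1)) * ?B powr (q z - 1) * \<bar>x - y\<bar>"
          using xy q(2)[of z] by (intro powr_Suc_lipschitz) auto
        then have "x powr q z \<le> y powr q z + q z * ?B powr (q z - 1) * \<bar>x - y\<bar>"
          by simp
        also have "q z * ?B powr (q z - 1) \<le> \<beta> * ?B powr \<beta>"
          using B q(2,3)[of z] \<beta> by (intro mult_mono powr_mono) auto
        finally show ?thesis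
          by (simp add: mult_right_mono)
      qed
      then have "\<phi> x \<le> (LINT z:?H|lebesgue. y powr q z + \<beta> * ?B powr \<beta> * \<bar>x - y\<bar>)"
        unfolding \<phi>_def using xy by (intro set_integral_mono set_integral_add int const_int) auto
      also have "\<dots> = \<phi> y + ?L * \<bar>x - y\<bar>"
        using xy unfolding \<phi>_def by (subst set_integral_add(2)) (auto simp: int const_int const)
      finally show ?thesis .
    qed
    show "?L-lipschitz_on {1..?B} \<phi>"
    proof (rule lipschitz_onI)
      show "dist (\<phi> x) (\<phi> y) \<le> ?L * dist x y" if "x \<in> {1..?B}" "y \<in> {1..?B}" for x y
        using le[OF that] le[OF that(2,1)] by (simp add: dist_real_def abs_minus_commute abs_le_iff)
      show "0 \<le> ?L"
        using \<beta> v by simp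
    qed
  qed
  moreover have "1 \<le> \<phi> (1 / ?v)"
    using scale[of "1 / ?v" 1] \<phi>1 v l by simp
  ultimately obtain T where T: "1 \<le> T" "\<phi> T = 1"
    using IVT'[of \<phi> 1 1 "1 / ?v"] \<phi>1 v by auto
  have "vnorm p (indicator (cbox a (\<chi> i. a $ i + l))) = ennreal (1 / T)"
    if p: "\<And>x. p x = ereal (q x)" for p
  proof -
    let ?Q = "cbox a (\<chi> i. a $ i + l)"
    have modular: "(\<integral>\<^sup>+x. epow (ennreal (\<bar>indicator ?Q x :: real\<bar> / t)) (p x) \<partial>lebesgue) = ennreal (\<phi> (1 / t))"
      if "0 < t" for t
    proof -
      have "(\<integral>\<^sup>+x. epow (ennreal (\<bar>indicator ?Q x :: real\<bar> / t)) (p x) \<partial>lebesgue)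
        = (\<integral>\<^sup>+x. ennreal ((1 / t) powr q x) * indicator ?Q x \<partial>lebesgue)"
        using that p by (intro nn_integral_cong) (auto simp: epow_ennreal epow_def split: split_indicator)
      also have "\<dots> = ennreal (\<phi> (1 / t))"
        unfolding \<phi>_def using that l by (intro nn_integral_cube int) auto
      finally show ?thesis .
    qed
    have iff: "0 < t \<and> ennreal (\<phi> (1 / t)) \<le> 1 \<longleftrightarrow> 1 / T \<le> t" for t
    proof (intro iffI conjI)
      assume t: "0 < t \<and> ennreal (\<phi> (1 / t)) \<le> 1"
      show "1 / T \<le> t"
      proof (rule ccontr)
        assume "\<not> 1 / T \<le> t"
        then have c: "1 < 1 / (t * T)"
          using T t by (simp add: field_simps)
        then have "1 / (t * T) \<le> \<phi> (1 / t)"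
          using scale[of "1 / (t * T)" T] T by simp
        then show False
          using c t by simp
      qed
    next
      assume t: "1 / T \<le> t"
      show pos: "0 < t"
        using t T by (smt (verit) divide_pos_pos)
      have "\<phi> (1 / t) \<le> \<phi> T"
        using t T pos by (intro mono) (auto simp: field_simps)
      then show "ennreal (\<phi> (1 / t)) \<le> 1"
        using T by simp
    qed
    have P_iff: "0 < t \<and> (\<integral>\<^sup>+x. epow (ennreal (\<bar>indicator ?Q x :: real\<bar> / t)) (p x) \<partial>lebesgue) \<le> 1
      \<longleftrightarrow> 1 / T \<le> t" for t
      using modular[of t] iff[of t] by (cases "0 < t") auto
    have set_eq: "{ennreal t | t. 0 < t \<and>
      (\<integral>\<^sup>+x. epow (ennreal (\<bar>indicator ?Q x :: real\<bar> / t)) (p x) \<partial>lebesgue) \<le> 1} = ennreal ` {1 / T..}"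
      unfolding P_iff by auto
    have "Inf (ennreal ` {1 / T..}) = ennreal (1 / T)"
    proof (rule antisym)
      show "Inf (ennreal ` {1 / T..}) \<le> ennreal (1 / T)"
        by (intro Inf_lower imageI) simp
      show "ennreal (1 / T) \<le> Inf (ennreal ` {1 / T..})"
        by (intro INF_greatest ennreal_leI) simp
    qed
    then show ?thesis
      unfolding vnorm_def set_eq .
  qed
  then show ?thesis
    using that T unfolding \<phi>_def by blast
qed

lemma A_condition_of_const_A:
  fixes p :: "real ^ 'n \<Rightarrow> ereal" and q :: "real ^ 'n \<Rightarrow> real"
  assumes q [measurable]: "q \<in> borel_measurable lebesgue"
    and \<alpha>: "1 < \<alpha>" "\<And>x. \<alpha> \<le> q x" and \<beta>: "\<And>x. q x \<le> \<beta>" and p: "\<And>x. p x = ereal (q x)"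
    and K: "const_A p \<le> ennreal K" "0 \<le> K"
  shows "A_condition q K"
  unfolding A_condition_def
proof (intro allI impI)
  fix a :: "real ^ 'n" and l :: real
  assume l: "0 < l" "l \<le> 1"
  let ?Q = "cbox a (\<chi> i. a $ i + l)" and ?v = "l ^ CARD('n)"
  have gt: "1 < q x" for x
    using \<alpha> by (rule less_le_trans)
  have conj_gt: "1 < q x / (q x - 1)" for x
    using gt[of x] by simp
  have conj_le: "q x / (q x - 1) \<le> \<alpha> / (\<alpha> - 1)" for x
    using \<alpha>(1) \<alpha>(2)[of x] by (simp add: field_simps)
  obtain T where T: "1 \<le> T" "(LINT x:hbox a l|lebesgue. T powr q x) = 1"
    and T_norm: "\<And>r. (\<And>x. r x = ereal (q x)) \<Longrightarrow> vnorm r (indicator ?Q) = ennreal (1 / T)"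
    using level_exists[OF q gt \<beta> l, where a = a] by blast
  note T = T T_norm[where r = p, OF p]
  have m: "(\<lambda>x. q x / (q x - 1)) \<in> borel_measurable lebesgue"
    by measurable
  obtain S where S: "1 \<le> S" "(LINT x:hbox a l|lebesgue. S powr (q x / (q x - 1))) = 1"
    and S_norm: "\<And>r. (\<And>x. r x = ereal (q x / (q x - 1))) \<Longrightarrow> vnorm r (indicator ?Q) = ennreal (1 / S)"
    using level_exists[OF m conj_gt conj_le l, where a = a] by blast
  note S = S S_norm[OF conj_exponent_ereal[where p = p, OF gt p]]
  have "?Q \<in> cubes"
    using l unfolding cubes_def by blast
  then have "vnorm p (indicator ?Q) * vnorm (conj_exponent p) (indicator ?Q) / emeasure lebesgue ?Q \<le> const_A p"
    unfolding const_A_def by (rule SUP_upper)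
  also note K(1)
  finally have "ennreal (1 / T * (1 / S) / ?v) \<le> ennreal K"
    using T S l by (simp add: emeasure_cube divide_ennreal del: emeasure_completion flip: ennreal_mult)
  then have "1 / T * (1 / S) / ?v \<le> K"
    using K(2) by simp
  then have "1 \<le> K * ?v * T * S"
    using T S l by (simp add: field_simps)
  then show "\<exists>T S. 1 \<le> T \<and> 1 \<le> S \<and> (LINT x:hbox a l|lebesgue. T powr q x) = 1 \<and>
    (LINT x:hbox a l|lebesgue. S powr (q x / (q x - 1))) = 1 \<and> 1 \<le> K * ?v * T * S"
    using T S by blast
qed

section \<open>Constants that serve all cubes\<close>

lemma uniform_cube_nn_integral:
  fixes a :: "real ^ 'n" and F :: "real ^ 'n \<Rightarrow> ennreal"
  assumes "0 < l" "F \<in> borel_measurable lebesgue"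
  shows "(\<integral>\<^sup>+x. F x \<partial>uniform_measure lebesgue (cbox a (\<chi> i. a $ i + l)))
    = (\<integral>\<^sup>+x. F x * indicator (cbox a (\<chi> i. a $ i + l)) x \<partial>lebesgue) / ennreal (l ^ CARD('n))"
  using assms by (simp add: nn_integral_uniform_measure emeasure_cube del: emeasure_completion)

lemma uniform_cube_nn_integral_le:
  fixes a :: "real ^ 'n" and F :: "real ^ 'n \<Rightarrow> real"
  assumes "0 < l" "F \<in> borel_measurable lebesgue" "\<And>x. 0 \<le> F x" "\<And>x. F x \<le> B" "0 \<le> C"
    and "(LINT x:hbox a l|lebesgue. F x) \<le> C * l ^ CARD('n)"
  shows "(\<integral>\<^sup>+x. ennreal (F x) \<partial>uniform_measure lebesgue (cbox a (\<chi> i. a $ i + l))) \<le> ennreal C"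
proof -
  have "set_integrable lebesgue (hbox a l) F"
    using assms by (intro set_integrable_bounded[where B = B]) auto
  then have "(\<integral>\<^sup>+x. ennreal (F x) \<partial>uniform_measure lebesgue (cbox a (\<chi> i. a $ i + l)))
    = ennreal (LINT x:hbox a l|lebesgue. F x) / ennreal (l ^ CARD('n))"
    using assms(1-3) by (subst uniform_cube_nn_integral) (auto simp: nn_integral_cube)
  also have "\<dots> \<le> ennreal (C * l ^ CARD('n)) / ennreal (l ^ CARD('n))"
    using assms(6) by (intro divide_right_mono_ennreal ennreal_leI)
  also have "\<dots> = ennreal C"
    using assms(1,5) by (subst divide_ennreal) auto
  finally show ?thesis .
qed

text \<open>
The reverse Hoelder inequality is used for q and for its conjugate, with bounds that both satisfy. The
second use gives the negative moment, because u^{-1/(q-1)} is at most a multiple of S^{q'} v.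
\<close>

lemma level_space_constants:
  fixes \<alpha> \<beta> K :: real
  assumes \<alpha>: "1 < \<alpha>" "\<alpha> \<le> \<beta>" and K: "1 \<le> K"
  obtains \<eta> C :: real where "0 < \<eta>" "1 \<le> C"
    "\<And>(q :: real ^ 'n \<Rightarrow> real) a l. exponent q \<alpha> \<beta> K \<Longrightarrow> 0 < l \<Longrightarrow> l \<le> 1 \<Longrightarrow>
      \<exists>T. level_space (uniform_measure lebesgue (cbox a (\<chi> i. a $ i + l))) q T (l ^ CARD('n)) \<alpha> \<beta> \<eta> C"
proof -
  \<comment> \<open>bounds for q and for its conjugate exponent at the same time\<close>
  define \<alpha>' \<beta>' where "\<alpha>' = min \<alpha> (\<beta> / (\<beta> - 1))" and "\<beta>' = max \<beta> (\<alpha> / (\<alpha> - 1))"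
  have \<alpha>': "1 < \<alpha>'" "\<alpha>' \<le> \<beta>'"
    using \<alpha> by (auto simp: \<alpha>'_def \<beta>'_def)
  obtain \<eta> C1 :: real where \<eta>: "0 < \<eta>" and C1: "0 < C1"
    and rh: "\<And>(q :: real ^ 'n \<Rightarrow> real) a l T. exponent q \<alpha>' \<beta>' K \<Longrightarrow> 0 < l \<Longrightarrow> l \<le> 1 \<Longrightarrow> 1 \<le> T \<Longrightarrow>
      (LINT x:hbox a l|lebesgue. T powr q x) = 1 \<Longrightarrow>
      (LINT x:hbox a l|lebesgue. (T powr q x * l ^ CARD('n)) powr (1 + \<eta>)) \<le> C1 * l ^ CARD('n)"
    using level_reverse_holder[OF \<alpha>' K] by metis
  define k where "k = K powr (\<alpha> / (\<alpha> - 1))"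
  have k: "1 \<le> k"
    using K \<alpha> by (simp add: k_def ge_one_powr_ge_zero)
  define C where "C = 1 + C1 + k powr (1 + \<eta>) * C1"
  have C: "1 \<le> C" "C1 \<le> C" "k powr (1 + \<eta>) * C1 \<le> C"
    using C1 by (auto simp: C_def)
  have "\<exists>T. level_space (uniform_measure lebesgue (cbox a (\<chi> i. a $ i + l))) q T (l ^ CARD('n)) \<alpha> \<beta> \<eta> C"
    if "exponent q \<alpha> \<beta> K" and l: "0 < l" "l \<le> 1" for q :: "real ^ 'n \<Rightarrow> real" and a l
  proof -
    interpret exponent q \<alpha> \<beta> K
      by fact
    let ?M = "uniform_measure lebesgue (cbox a (\<chi> i. a $ i + l))" and ?v = "l ^ CARD('n)"
    let ?r = "\<lambda>x. q x / (q x - 1)"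
    have v: "0 < ?v"
      using l by simp
    have r_ge: "\<beta> / (\<beta> - 1) \<le> ?r x" for x
      using \<alpha> q_gt[of x] q_le[of x] by (simp add: field_simps)
    have r_gt: "1 < ?r x" for x
      using q_gt[of x] by simp
    have q_exp: "exponent q \<alpha>' \<beta>' K"
      using \<alpha>' q_ge q_le K A
      by unfold_locales (auto simp: \<alpha>'_def \<beta>'_def intro: min.coboundedI1 max.coboundedI1)
    have r_exp: "exponent ?r \<alpha>' \<beta>' K"
      using \<alpha>' r_ge conj_le K A_condition_conjugate[OF A q_gt]
      by unfold_locales (auto simp: \<alpha>'_def \<beta>'_def intro: min.coboundedI2 max.coboundedI2)
    obtain T S where TS: "1 \<le> T" "1 \<le> S" "(LINT x:hbox a l|lebesgue. T powr q x) = 1"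
      "(LINT x:hbox a l|lebesgue. S powr ?r x) = 1" "1 \<le> K * ?v * T * S"
      using A l unfolding A_condition_def by blast
    interpret W: bounded_weight "\<lambda>x. T powr q x" 1 "T powr \<beta>"
      using TS by (intro powr_weight)
    have "level_space ?M q T ?v \<alpha> \<beta> \<eta> C"
    proof
      show "emeasure ?M (space ?M) = 1"
        using l v by (simp add: emeasure_cube del: emeasure_completion)
      show "q \<in> borel_measurable ?M"
        by simp
      have "(LINT x:hbox a l|lebesgue. T powr q x) \<le> (LINT x:hbox a l|lebesgue. T powr \<beta>)"
        using l W.w_le by (intro set_integral_mono W.integrable_w set_integrable_const_within) auto
      then show "1 \<le> T powr \<beta> * ?v"
        using TS l by (simp add: set_integral_const_hbox)
      show "(\<integral>\<^sup>+x. ennreal ((T powr q x * ?v) powr (1 + \<eta>)) \<partial>?M) \<le> ennreal C"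
      proof (rule uniform_cube_nn_integral_le)
        show "(T powr q x * ?v) powr (1 + \<eta>) \<le> (T powr \<beta> * ?v) powr (1 + \<eta>)" for x
          using v \<eta> W.w_le by (intro powr_mono2 mult_right_mono) auto
        have "C1 * ?v \<le> C * ?v"
          using C v by (intro mult_right_mono) auto
        then show "(LINT x:hbox a l|lebesgue. (T powr q x * ?v) powr (1 + \<eta>)) \<le> C * ?v"
          using rh[OF q_exp l, of T a] TS by simp
      qed (use l C in auto)
      have "(\<integral>\<^sup>+x. ennreal ((T powr q x * ?v) powr - ((1 + \<eta>) / (q x - 1))) \<partial>?M)
        \<le> (\<integral>\<^sup>+x. ennreal (k powr (1 + \<eta>)) * ennreal ((S powr ?r x * ?v) powr (1 + \<eta>)) \<partial>?M)"
      proof (intro nn_integral_mono)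
        fix x
        have "(T powr q x * ?v) powr - (1 / (q x - 1)) \<le> K powr ?r x * (S powr ?r x * ?v)"
          using TS v K q_gt by (intro dual_weight_le) auto
        also have "\<dots> \<le> k * (S powr ?r x * ?v)"
          unfolding k_def using v K conj_le[of x] by (intro mult_right_mono powr_mono) auto
        finally have "((T powr q x * ?v) powr - (1 / (q x - 1))) powr (1 + \<eta>) \<le> (k * (S powr ?r x * ?v)) powr (1 + \<eta>)"
          using \<eta> by (intro powr_mono2) auto
        also have "((T powr q x * ?v) powr - (1 / (q x - 1))) powr (1 + \<eta>)
          = (T powr q x * ?v) powr - ((1 + \<eta>) / (q x - 1))"
          unfolding powr_powr by (intro arg_cong2[where f = "(powr)"]) (auto simp: field_simps)
        also have "(k * (S powr ?r x * ?v)) powr (1 + \<eta>) = k powr (1 + \<eta>) * (S powr ?r x * ?v) powr (1 + \<eta>)"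
          by (rule powr_mult)
        finally show "ennreal ((T powr q x * ?v) powr - ((1 + \<eta>) / (q x - 1)))
          \<le> ennreal (k powr (1 + \<eta>)) * ennreal ((S powr ?r x * ?v) powr (1 + \<eta>))"
          by (simp add: ennreal_leI flip: ennreal_mult)
      qed
      also have "\<dots> = ennreal (k powr (1 + \<eta>)) * (\<integral>\<^sup>+x. ennreal ((S powr ?r x * ?v) powr (1 + \<eta>)) \<partial>?M)"
        by (rule nn_integral_cmult) simp
      also have "\<dots> \<le> ennreal (k powr (1 + \<eta>)) * ennreal C1"
      proof (intro mult_left_mono uniform_cube_nn_integral_le)
        have "S powr ?r x \<le> S powr (\<alpha> / (\<alpha> - 1))" for x
          using TS conj_le by (intro powr_mono) auto
        then show "(S powr ?r x * ?v) powr (1 + \<eta>) \<le> (S powr (\<alpha> / (\<alpha> - 1)) * ?v) powr (1 + \<eta>)" for x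
          using v \<eta> by (intro powr_mono2 mult_right_mono) auto
        show "(LINT x:hbox a l|lebesgue. (S powr ?r x * ?v) powr (1 + \<eta>)) \<le> C1 * ?v"
          using rh[OF r_exp l, of S a] TS by simp
      qed (use l C1 in auto)
      also have "\<dots> \<le> ennreal C"
        using C C1 by (simp add: ennreal_leI flip: ennreal_mult)
      finally show "(\<integral>\<^sup>+x. ennreal ((T powr q x * ?v) powr - ((1 + \<eta>) / (q x - 1))) \<partial>?M) \<le> ennreal C" .
    qed (use \<alpha> q_ge q_le TS v \<eta> C in auto)
    then show ?thesis
      by blast
  qed
  then show ?thesis
    using that \<eta> C by blast
qed

text \<open>
Each condition on s0 holds strictly at s0 = 1, since (\<alpha> + \<eta>) < \<alpha> (1 + \<eta>). The second
choice for s0 is also smaller than \<alpha>, which leaves room for a.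
\<close>

lemma admissible_scale_exists:
  fixes \<alpha> \<beta> \<eta> :: real
  assumes "1 < \<alpha>" "\<alpha> \<le> \<beta>" "0 < \<eta>"
  obtains s0 a :: real where "1 < s0" "s0 ^ 2 \<le> 1 + \<eta>" "s0 * (\<alpha> + \<eta>) \<le> \<alpha> * (1 + \<eta>)"
    "0 < a" "a * s0 * (\<beta> - 1) \<le> 1" "a \<le> \<alpha> / s0 - 1"
proof -
  define s0 where "s0 = min (sqrt (1 + \<eta>)) (\<alpha> * (1 + \<eta>) / (\<alpha> + \<eta>))"
  define a where "a = min (1 / (s0 * (\<beta> - 1))) (\<alpha> / s0 - 1)"
  have "\<alpha> + \<eta> < \<alpha> * (1 + \<eta>)"
    using assms by (simp add: algebra_simps)
  then have s0: "1 < s0"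
    using assms by (simp add: s0_def)
  have s0_le: "s0 \<le> sqrt (1 + \<eta>)" "s0 \<le> \<alpha> * (1 + \<eta>) / (\<alpha> + \<eta>)"
    by (auto simp: s0_def)
  have "s0 ^ 2 \<le> (sqrt (1 + \<eta>)) ^ 2"
    using s0 s0_le by (intro power_mono) auto
  then have 1: "s0 ^ 2 \<le> 1 + \<eta>"
    using assms by simp
  have 2: "s0 * (\<alpha> + \<eta>) \<le> \<alpha> * (1 + \<eta>)"
    using s0_le(2) assms by (simp add: pos_le_divide_eq)
  have "\<alpha> * (1 + \<eta>) / (\<alpha> + \<eta>) < \<alpha>"
    using assms by (simp add: divide_less_eq)
  then have "s0 < \<alpha>"
    using s0_le(2) by simp
  then have 3: "0 < a"
    using assms s0 by (simp add: a_def)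
  have "a \<le> 1 / (s0 * (\<beta> - 1))" and 4: "a \<le> \<alpha> / s0 - 1"
    by (auto simp: a_def)
  then have "a * (s0 * (\<beta> - 1)) \<le> 1"
    using assms s0 by (simp add: pos_le_divide_eq)
  then show ?thesis
    using that[of s0 a] s0 1 2 3 4 by (simp add: mult_ac)
qed

section \<open>The sum norm and the estimate for all cubes\<close>

lemma sum_norm_decomposition:
  fixes p :: "real ^ 'n \<Rightarrow> ereal" and q :: "real ^ 'n \<Rightarrow> real"
  assumes q: "\<And>x. 1 < q x" "\<And>x. p x = ereal (q x)" and s: "1 \<le> s" and f: "sum_norm p s f \<le> 1"
  obtains g1 g2 g3 where
    "g1 \<in> borel_measurable lebesgue" "g2 \<in> borel_measurable lebesgue" "g3 \<in> borel_measurable lebesgue"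
    "(\<integral>\<^sup>+x. ennreal ((\<bar>g1 x\<bar> / 2) powr (q x / s)) \<partial>lebesgue) \<le> 1"
    "(\<integral>\<^sup>+x. ennreal ((\<bar>g2 x\<bar> / 2) powr q x) \<partial>lebesgue) \<le> 1"
    "AE x in lebesgue. \<bar>g3 x\<bar> \<le> 2"
    "AE x in lebesgue. f x = g1 x + g2 x + g3 x"
proof -
  have "sum_norm p s f < 2"
    using f by (rule le_less_trans) simp
  then obtain g1 g2 g3 where g: "vnorm (\<lambda>x. p x / ereal s) g1 + vnorm p g2 + vnorm (\<lambda>x. \<infinity>) g3 < 2"
    "g1 \<in> vspace (\<lambda>x. p x / ereal s)" "g2 \<in> vspace p" "g3 \<in> vspace (\<lambda>x. \<infinity>)"
    "AE x in lebesgue. f x = g1 x + g2 x + g3 x"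
    unfolding sum_norm_def Inf_less_iff by blast
  have meas: "g \<in> borel_measurable lebesgue" if "g \<in> vspace r" for g :: "real ^ 'n \<Rightarrow> real" and r
  proof (rule borel_measurable_LIMSEQ_metric)
    show "(\<lambda>x. indicator (cball 0 (real n)) x *\<^sub>R g x) \<in> borel_measurable lebesgue" for n :: nat
      using that unfolding vspace_def locally_integrable_def set_integrable_def
      by (intro borel_measurable_integrable) auto
    show "(\<lambda>n. indicator (cball 0 (real n)) x *\<^sub>R g x) \<longlonglongrightarrow> g x" for x
    proof (rule tendsto_eventually, rule eventually_sequentiallyI)
      show "indicator (cball 0 (real n)) x *\<^sub>R g x = g x" if "nat \<lceil>norm x\<rceil> \<le> n" for n
        using that by (auto simp: nat_le_iff ceiling_le_iff split: split_indicator)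
    qed
  qed
  have ps: "p x / ereal s = ereal (q x / s)" for x
    using q s by simp
  have less: "vnorm (\<lambda>x. p x / ereal s) g1 < 2" "vnorm p g2 < 2" "vnorm (\<lambda>x. \<infinity>) g3 < 2"
    using g(1) by (auto elim!: le_less_trans[rotated] intro: add_increasing add_increasing2)
  have q_pos: "0 \<le> q x" for x
    using q(1)[of x] by simp
  have 1: "(\<integral>\<^sup>+x. ennreal ((\<bar>g1 x\<bar> / 2) powr (q x / s)) \<partial>lebesgue) \<le> 1"
    using modular_two_le_one[OF less(1)] q_pos s by (simp add: ps epow_ennreal del: ereal_divide)
  have 2: "(\<integral>\<^sup>+x. ennreal ((\<bar>g2 x\<bar> / 2) powr q x) \<partial>lebesgue) \<le> 1"
    using modular_two_le_one[OF less(2)] q_pos by (simp add: q(2) epow_ennreal)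
  have [measurable]: "g3 \<in> borel_measurable lebesgue"
    using g(4) by (rule meas)
  have "(\<integral>\<^sup>+x. epow (ennreal (\<bar>g3 x\<bar> / 2)) \<infinity> \<partial>lebesgue) \<le> 1"
    using modular_two_le_one[OF less(3)] by simp
  then have "(\<integral>\<^sup>+x. epow (ennreal (\<bar>g3 x\<bar> / 2)) \<infinity> \<partial>lebesgue) \<noteq> \<infinity>"
    by (auto simp: top_unique)
  then have "AE x in lebesgue. epow (ennreal (\<bar>g3 x\<bar> / 2)) \<infinity> \<noteq> \<infinity>"
    by (intro nn_integral_noteq_infinite) (auto simp: epow_def)
  then have 3: "AE x in lebesgue. \<bar>g3 x\<bar> \<le> 2"
    by (rule eventually_mono) (auto simp: epow_def split: if_splits)
  show ?thesis
    using that[OF meas[OF g(2)] meas[OF g(3)] meas[OF g(4)] 1 2 3 g(5)] .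
qed

text \<open>
The factor v cancels the normalization of the mean over the cube.
\<close>

lemma uniform_modular_le:
  fixes a :: "real ^ 'n" and F :: "real ^ 'n \<Rightarrow> real"
  assumes l: "0 < l" and F [measurable]: "F \<in> borel_measurable lebesgue" "\<And>x. 0 \<le> F x"
    and le: "(\<integral>\<^sup>+x. ennreal (F x) \<partial>lebesgue) \<le> 1"
  shows "(\<integral>\<^sup>+x. ennreal (F x * l ^ CARD('n)) \<partial>uniform_measure lebesgue (cbox a (\<chi> i. a $ i + l))) \<le> 1"
proof -
  let ?Q = "cbox a (\<chi> i. a $ i + l)" and ?v = "l ^ CARD('n)"
  have [measurable]: "?Q \<in> sets lebesgue"
    by simp
  have "(\<integral>\<^sup>+x. ennreal (F x * ?v) \<partial>uniform_measure lebesgue ?Q)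
    = (\<integral>\<^sup>+x. ennreal (F x) * indicator ?Q x * ennreal ?v \<partial>lebesgue) / ennreal ?v"
    using l F(2) by (subst uniform_cube_nn_integral)
      (auto simp: ennreal_mult mult_ac intro!: arg_cong2[where f = "(/)"] nn_integral_cong)
  also have "\<dots> = (\<integral>\<^sup>+x. ennreal (F x) * indicator ?Q x \<partial>lebesgue)"
    using l by (subst nn_integral_multc) (auto intro!: ennreal_mult_divide_eq)
  also have "\<dots> \<le> (\<integral>\<^sup>+x. ennreal (F x) \<partial>lebesgue)"
    by (intro nn_integral_mono) (auto split: split_indicator)
  also note le
  finally show ?thesis .
qed

lemma avg_cube:
  "F \<in> borel_measurable lebesgue \<Longrightarrow>
    avg (cbox a b) F = (\<integral>\<^sup>+x. F x \<partial>uniform_measure lebesgue (cbox a b))"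
  by (simp add: avg_def nn_integral_uniform_measure)

theorem theorem2p4:
  fixes pm pp :: ereal and KA KN :: ennreal
  assumes "1 < pm" and "pm \<le> pp" and "pp < \<infinity>"
  shows "\<exists>(s0::real) (c::real) (\<epsilon>::real). 1 < s0 \<and> 0 < c \<and> 0 < \<epsilon> \<and>
    (\<forall>p :: real ^ 'n \<Rightarrow> ereal.
      variable_exponent p \<longrightarrow> (\<forall>x. pm \<le> p x \<and> p x \<le> pp) \<longrightarrow>
      p \<in> class_A \<inter> class_N pm pp \<longrightarrow> const_A p = KA \<longrightarrow> const_N pm pp p = KN \<longrightarrow>
      (\<forall>s\<in>{1..s0}. \<forall>Q\<in>cubes. emeasure lebesgue Q \<le> 1 \<longrightarrow>
        (\<forall>f :: real ^ 'n \<Rightarrow> real. sum_norm p s f \<le> 1 \<longrightarrow>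
          epow (avg Q (\<lambda>x. epow (avg Q (\<lambda>y. ennreal \<bar>f y\<bar>)) (ereal s * p x))) (ereal (1 / s))
          \<le> ennreal c * epow (avg Q (\<lambda>x. epow (ennreal \<bar>f x\<bar>) (p x / ereal s))) (ereal s)
            + epow (emeasure lebesgue Q) (ereal \<epsilon>))))"
proof -
  obtain \<alpha> where pm: "pm = ereal \<alpha>"
    using assms by (cases pm) auto
  obtain \<beta> where pp: "pp = ereal \<beta>"
    using assms by (cases pp) auto
  have \<alpha>: "1 < \<alpha>" and \<beta>: "\<alpha> \<le> \<beta>"
    using assms by (auto simp: pm pp one_ereal_def)
  define K where "K = max 1 (enn2real KA)"
  have K: "1 \<le> K"
    by (simp add: K_def)
  obtain \<eta> C :: real where \<eta>: "0 < \<eta>" and C: "1 \<le> C"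
    and level: "\<And>(q :: real ^ 'n \<Rightarrow> real) a l. exponent q \<alpha> \<beta> K \<Longrightarrow> 0 < l \<Longrightarrow> l \<le> 1 \<Longrightarrow>
      \<exists>T. level_space (uniform_measure lebesgue (cbox a (\<chi> i. a $ i + l))) q T (l ^ CARD('n)) \<alpha> \<beta> \<eta> C"
    using level_space_constants[OF \<alpha> \<beta> K] by blast
  obtain s0 b :: real where scale: "1 < s0" "s0 ^ 2 \<le> 1 + \<eta>" "s0 * (\<alpha> + \<eta>) \<le> \<alpha> * (1 + \<eta>)"
    "0 < b" "b * s0 * (\<beta> - 1) \<le> 1" "b \<le> \<alpha> / s0 - 1"
    using admissible_scale_exists[OF \<alpha> \<beta> \<eta>] by blast
  \<comment> \<open>two summands of size 2 (1 + 2 C) T^s from the Lebesgue parts and one of size 2 from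
    the bounded part\<close>
  define C0 where "C0 = 4 * (1 + 2 * C) + 2"
  have C0: "1 \<le> C0"
    using C by (simp add: C0_def)
  define c where "c = C0 powr \<beta> * (2 * C) * (2 * (4 * C) powr \<beta>) powr s0"
  have c: "0 < c"
    using C C0 by (simp add: c_def)
  have main: "epow (avg Q (\<lambda>x. epow (avg Q (\<lambda>y. ennreal \<bar>f y\<bar>)) (ereal s * p x))) (ereal (1 / s))
      \<le> ennreal c * epow (avg Q (\<lambda>x. epow (ennreal \<bar>f x\<bar>) (p x / ereal s))) (ereal s)
        + epow (emeasure lebesgue Q) (ereal (b / \<beta>))"
    if p: "variable_exponent p" "\<forall>x. pm \<le> p x \<and> p x \<le> pp" "p \<in> class_A" "const_A p = KA"
      and s: "1 \<le> s" "s \<le> s0" and Q: "Q \<in> cubes" "emeasure lebesgue Q \<le> 1"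
      and f: "sum_norm p s f \<le> 1"
    for p :: "real ^ 'n \<Rightarrow> ereal" and s Q and f :: "real ^ 'n \<Rightarrow> real"
  proof -
    define q where "q x = real_of_ereal (p x)" for x
    have p_q: "p x = ereal (q x)" for x
      using p(2)[rule_format, of x] by (cases "p x") (auto simp: q_def pm pp)
    have q_bounds: "\<alpha> \<le> q x" "q x \<le> \<beta>" for x
      using p(2)[rule_format, of x] by (auto simp: p_q pm pp)
    have [measurable]: "p \<in> borel_measurable lebesgue"
      using p(1) by (simp add: variable_exponent_def)
    have [measurable]: "q \<in> borel_measurable lebesgue"
      unfolding q_def by measurable
    have "const_A p \<le> ennreal K"
      using p(3,4) by (cases KA) (auto simp: class_A_def K_def intro!: ennreal_leI)
    then have "A_condition q K"
      using K q_bounds \<alpha> p_q by (intro A_condition_of_const_A) auto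
    then have "exponent q \<alpha> \<beta> K"
      using \<alpha> q_bounds K by unfold_locales auto
    obtain a l where l: "0 < l" and Q_eq: "Q = cbox a (\<chi> i. a $ i + l)"
      using Q(1) unfolding cubes_def by blast
    let ?v = "l ^ CARD('n)" and ?M = "uniform_measure lebesgue Q"
    have Q_meas: "emeasure lebesgue Q = ennreal ?v"
      unfolding Q_eq using l by (rule emeasure_cube)
    then have "?v \<le> 1"
      using Q(2) by simp
    then have l1: "l \<le> 1"
      using l by (meson not_le one_less_power zero_less_card_finite)
    obtain T where "level_space ?M q T ?v \<alpha> \<beta> \<eta> C"
      using level[OF \<open>exponent q \<alpha> \<beta> K\<close> l l1, of a] unfolding Q_eq by blast
    then interpret admissible_scale ?M q T ?v \<alpha> \<beta> \<eta> C s0 b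
      using scale by (simp add: admissible_scale_def admissible_scale_axioms_def)
    obtain g1 g2 g3 where g_meas [measurable]: "g1 \<in> borel_measurable lebesgue"
        "g2 \<in> borel_measurable lebesgue" "g3 \<in> borel_measurable lebesgue"
      and g1: "(\<integral>\<^sup>+x. ennreal ((\<bar>g1 x\<bar> / 2) powr (q x / s)) \<partial>lebesgue) \<le> 1"
      and g2: "(\<integral>\<^sup>+x. ennreal ((\<bar>g2 x\<bar> / 2) powr q x) \<partial>lebesgue) \<le> 1"
      and g3: "AE x in lebesgue. \<bar>g3 x\<bar> \<le> 2"
      and f_eq: "AE x in lebesgue. f x = g1 x + g2 x + g3 x"
      using sum_norm_decomposition[OF p_gt p_q s(1) f] by blast
    have "(\<lambda>x. g1 x + g2 x + g3 x) \<in> borel_measurable lebesgue"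
      by measurable
    then have f_meas [measurable]: "f \<in> borel_measurable lebesgue"
      by (rule borel_measurable_AE) (use f_eq in \<open>auto elim!: eventually_mono\<close>)
    have Q_sets: "Q \<in> sets lebesgue"
      by (simp add: Q_eq)
    have T_pow: "1 \<le> T powr s"
      using T s by (intro ge_one_powr_ge_zero) auto
    \<comment> \<open>the three parts of f have means bounded by multiples of T^s; the second one uses
      the scale 1\<close>
    have m1: "(\<integral>\<^sup>+x. ennreal \<bar>g1 x\<bar> \<partial>?M) \<le> ennreal (2 * (1 + 2 * C) * T powr s)"
      by (rule mean_le_level[OF s]) (use uniform_modular_le[OF l _ _ g1, of a] in \<open>auto simp: Q_eq\<close>)
    have "(\<integral>\<^sup>+x. ennreal \<bar>g2 x\<bar> \<partial>?M) \<le> ennreal (2 * (1 + 2 * C) * T powr 1)"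
      by (rule mean_le_level)
        (use uniform_modular_le[OF l _ _ g2, of a] scale(1) in \<open>auto simp: Q_eq\<close>)
    also have "\<dots> \<le> ennreal (2 * (1 + 2 * C) * T powr s)"
      using T s C by (intro ennreal_leI mult_left_mono powr_mono) auto
    finally have m2: "(\<integral>\<^sup>+x. ennreal \<bar>g2 x\<bar> \<partial>?M) \<le> ennreal (2 * (1 + 2 * C) * T powr s)" .
    have "AE x in ?M. \<bar>g3 x\<bar> \<le> 2"
      using Q_sets g3 by (intro AE_uniform_measureI) (auto elim!: eventually_mono)
    then have "(\<integral>\<^sup>+x. ennreal \<bar>g3 x\<bar> \<partial>?M) \<le> (\<integral>\<^sup>+x. ennreal 2 \<partial>?M)"
      by (intro nn_integral_mono_AE) (auto elim!: eventually_mono intro!: ennreal_leI simp del: ennreal_numeral)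
    also have "\<dots> = ennreal 2"
      using total by simp
    also have "\<dots> \<le> ennreal (2 * T powr s)"
      using T_pow by (intro ennreal_leI) simp
    finally have m3: "(\<integral>\<^sup>+x. ennreal \<bar>g3 x\<bar> \<partial>?M) \<le> ennreal (2 * T powr s)" .
    have "AE x in ?M. f x = g1 x + g2 x + g3 x"
      using Q_sets f_eq by (intro AE_uniform_measureI) (auto elim!: eventually_mono)
    then have "(\<integral>\<^sup>+x. ennreal \<bar>f x\<bar> \<partial>?M)
      \<le> (\<integral>\<^sup>+x. ennreal \<bar>g1 x\<bar> + ennreal \<bar>g2 x\<bar> + ennreal \<bar>g3 x\<bar> \<partial>?M)"
      by (intro nn_integral_mono_AE) (auto elim!: eventually_mono intro!: ennreal_leI simp flip: ennreal_plus)
    also have "\<dots> = (\<integral>\<^sup>+x. ennreal \<bar>g1 x\<bar> \<partial>?M) + (\<integral>\<^sup>+x. ennreal \<bar>g2 x\<bar> \<partial>?M) + (\<integral>\<^sup>+x. ennreal \<bar>g3 x\<bar> \<partial>?M)"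
      by (simp add: nn_integral_add)
    also have "\<dots> \<le> ennreal (2 * (1 + 2 * C) * T powr s) + ennreal (2 * (1 + 2 * C) * T powr s) + ennreal (2 * T powr s)"
      by (intro add_mono m1 m2 m3)
    also have "\<dots> = ennreal (C0 * T powr s)"
      using C by (simp add: C0_def algebra_simps flip: ennreal_plus)
    finally have mean_le: "(\<integral>\<^sup>+x. ennreal \<bar>f x\<bar> \<partial>?M) \<le> ennreal (C0 * T powr s)" .
    then obtain t where t: "(\<integral>\<^sup>+x. ennreal \<bar>f x\<bar> \<partial>?M) = ennreal t" "0 \<le> t"
      by (cases "\<integral>\<^sup>+x. ennreal \<bar>f x\<bar> \<partial>?M") (auto simp: top_unique)
    have t_le: "t \<le> C0 * T powr s"
      using mean_le C0 unfolding t(1) by simp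
    have avg_f: "avg Q (\<lambda>y. ennreal \<bar>f y\<bar>) = ennreal t"
      unfolding t(1)[symmetric] Q_eq by (rule avg_cube) measurable
    have avg_L: "avg Q (\<lambda>x. epow (ennreal t) (ereal s * p x)) = (\<integral>\<^sup>+x. ennreal (t powr (s * q x)) \<partial>?M)"
      using t(2) unfolding Q_eq by (simp add: p_q epow_ennreal avg_cube)
    have ps: "p x / ereal s = ereal (q x / s)" for x
      using p_q s by simp
    have avg_X: "avg Q (\<lambda>x. epow (ennreal \<bar>f x\<bar>) (p x / ereal s)) = (\<integral>\<^sup>+x. ennreal (\<bar>f x\<bar> powr (q x / s)) \<partial>?M)"
      unfolding Q_eq ps by (simp add: epow_ennreal avg_cube)
    have "(\<integral>\<^sup>+x. ennreal (t powr (s * q x)) \<partial>?M) \<le> (\<integral>\<^sup>+x. ennreal (max 1 t powr (s * \<beta>)) \<partial>?M)"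
    proof (intro nn_integral_mono ennreal_leI)
      fix x
      have "t powr (s * q x) \<le> max 1 t powr (s * q x)"
        using t(2) s p_gt[of x] by (intro powr_mono2) auto
      also have "\<dots> \<le> max 1 t powr (s * \<beta>)"
        using s q_bounds by (intro powr_mono mult_left_mono) auto
      finally show "t powr (s * q x) \<le> max 1 t powr (s * \<beta>)" .
    qed
    also have "\<dots> < \<infinity>"
      using total by simp
    finally obtain L where L: "(\<integral>\<^sup>+x. ennreal (t powr (s * q x)) \<partial>?M) = ennreal L" "0 \<le> L"
      by (cases "\<integral>\<^sup>+x. ennreal (t powr (s * q x)) \<partial>?M") auto
    show ?thesis
    proof (cases "\<integral>\<^sup>+x. ennreal (\<bar>f x\<bar> powr (q x / s)) \<partial>?M")
      case (real X)
      have f_M: "f \<in> borel_measurable ?M"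
        by simp
      have "L powr (1 / s) \<le> c * X powr s + ?v powr (b / \<beta>)"
        unfolding c_def by (rule mean_modular_estimate[OF s C0 f_M t t_le real(2,1) L])
      then have "ennreal (L powr (1 / s)) \<le> ennreal (c * X powr s + ?v powr (b / \<beta>))"
        by (rule ennreal_leI)
      also have "\<dots> = ennreal c * ennreal (X powr s) + ennreal (?v powr (b / \<beta>))"
        using c by (simp add: ennreal_mult)
      finally show ?thesis
        using real L l unfolding avg_f avg_L avg_X Q_meas by (simp add: epow_ennreal)
    next
      case top
      then show ?thesis
        using c unfolding avg_X by (simp add: epow_def ennreal_mult_top)
    qed
  qed
  show ?thesis
    using main scale(1,4) c \<alpha> \<beta> by (intro exI[of _ s0] exI[of _ c] exI[of _ "b / \<beta>"]) auto
qed

end
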